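(* Let $k\ge1$, let $p_1,\ldots,p_k,q\ge1$ be integers and $\sigma_1,\ldots,\sigma_k,\sigma\in\{\pm1\}$ with $(q,\sigma)\ne(1,1)$. If the sum $p_1+\cdots+p_k+q+k$ and the integer $\frac{1-\sigma_1\cdots\sigma_k}{2}$ are of the same parity, then the Euler $\tilde S$-sum $\tilde S_{p_1,\ldots,p_k,q}^{\sigma_1,\ldots,\sigma_k,\sigma}$ of degree $k$ is reducible to (i.e. is a polynomial with rational coefficients in) (alternating) Euler $\tilde S$-sums and (alternating) Euler $R$-sums of degrees lower than $k$.
   Context: For $\sigma\in\{\pm1\}$, $n\ge0$, $r\ge1$: $h_n^{(r)}(\sigma)=\sum_{j=1}^n\frac{\sigma^{j-1}}{(j-1/2)^r}$ and $H_n^{(r)}(\sigma)=\sum_{j=1}^n\frac{\sigma^{j-1}}{j^r}$. For $(q,\sigma)\ne(1,1)$ and $k\ge0$, the (alternating) Euler $\tilde S$-sums and Euler $R$-sums of degree $k$ are $\tilde S_{p_1,\ldots,p_k,q}^{\sigma_1,\ldots,\sigma_k,\sigma}=\sum_{n\ge1}\sigma^{n-1}\frac{h_{n}^{(p_1)}(\sigma_1)\cdots h_{n}^{(p_k)}(\sigma_k)}{n^q}$ and $R_{p_1,\ldots,p_k,q}^{\sigma_1,\ldots,\sigma_k,\sigma}=\sum_{n\ge1}\sigma^{n-1}\frac{H_{n-1}^{(p_1)}(\sigma_1)\cdots H_{n-1}^{(p_k)}(\sigma_k)}{(n-1/2)^q}$. Degree $0$ sums are $\sum_{n\ge1}\frac{\sigma^{n-1}}{n^q}$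 and $\sum_{n\ge1}\frac{\sigma^{n-1}}{(n-1/2)^q}$ (e.g. $\ln 2=\sum_{n\ge1}(-1)^{n-1}/n$). *)

theory Defs
  imports Complex_Main "HOL-Library.Multiset"
begin

definition h_sum :: "nat \<Rightarrow> int \<Rightarrow> nat \<Rightarrow> real" where
  "h_sum r \<sigma> n = (\<Sum>j=1..n. of_int \<sigma> ^ (j - 1) / (real j - 1/2) ^ r)"

definition H_sum :: "nat \<Rightarrow> int \<Rightarrow> nat \<Rightarrow> real" where
  "H_sum r \<sigma> n = (\<Sum>j=1..n. of_int \<sigma> ^ (j - 1) / real j ^ r)"

text \<open>
  In a sum of degree \<open>k\<close> only the values \<open>p i\<close> and \<open>s i\<close> with \<open>1 \<le> i \<le> k\<close> matter.
  The series below run over \<open>n = m + 1\<close> with \<open>m \<ge> 0\<close>, and \<^const>\<open>suminf\<close> is the limit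
  of the partial sums, so the conditionally convergent case \<open>q = 1\<close>, \<open>\<sigma> = -1\<close> is covered.
\<close>

definition euler_index :: "nat \<Rightarrow> (nat \<Rightarrow> nat) \<Rightarrow> (nat \<Rightarrow> int) \<Rightarrow> nat \<Rightarrow> int \<Rightarrow> bool" where
  "euler_index k p s q \<sigma> \<longleftrightarrow>
     (\<forall>i\<in>{1..k}. 1 \<le> p i \<and> s i \<in> {1, -1}) \<and> 1 \<le> q \<and> \<sigma> \<in> {1, -1} \<and> (q, \<sigma>) \<noteq> (1, 1)"

definition euler_S :: "nat \<Rightarrow> (nat \<Rightarrow> nat) \<Rightarrow> (nat \<Rightarrow> int) \<Rightarrow> nat \<Rightarrow> int \<Rightarrow> real" where
  "euler_S k p s q \<sigma> =
     (\<Sum>m. of_int \<sigma> ^ m * (\<Prod>i=1..k. h_sum (p i) (s i) (m + 1)) / real (m + 1) ^ q)"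

definition euler_R :: "nat \<Rightarrow> (nat \<Rightarrow> nat) \<Rightarrow> (nat \<Rightarrow> int) \<Rightarrow> nat \<Rightarrow> int \<Rightarrow> real" where
  "euler_R k p s q \<sigma> =
     (\<Sum>m. of_int \<sigma> ^ m * (\<Prod>i=1..k. H_sum (p i) (s i) m) / (real (m + 1) - 1/2) ^ q)"

definition euler_sums_below :: "nat \<Rightarrow> real set" where
  "euler_sums_below k =
     {euler_S l p s q \<sigma> | l p s q \<sigma>. l < k \<and> euler_index l p s q \<sigma>} \<union>
     {euler_R l p s q \<sigma> | l p s q \<sigma>. l < k \<and> euler_index l p s q \<sigma>}"

text \<open>
  \<open>x\<close> is the value of a polynomial with rational coefficients at finitely many elements
  of \<open>A\<close>: the multisets in \<open>M\<close> are the monomials and \<open>c\<close> gives their coefficients. The empty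
  multiset is the constant monomial.
\<close>

definition rat_polynomial_in :: "real set \<Rightarrow> real \<Rightarrow> bool" where
  "rat_polynomial_in A x \<longleftrightarrow>
     (\<exists>(M :: real multiset set) (c :: real multiset \<Rightarrow> rat).
        finite M \<and> (\<forall>m\<in>M. set_mset m \<subseteq> A) \<and>
        x = (\<Sum>m\<in>M. of_rat (c m) * prod_mset m))"

end

theory Submission
  imports Defs "HOL-Complex_Analysis.Complex_Analysis"
begin

text \<open>
  Put \<open>F\<^sub>i(z) = \<Sum>j\<ge>1. s\<^sub>i ^ (j - 1) / (j - 1/2 - z) ^ p\<^sub>i\<close>, suitably normalised if the series
  diverges, and let \<open>K(z)\<close> be \<open>\<pi> cot (\<pi> z)\<close> or \<open>\<pi> / sin (\<pi> z)\<close> according to the sign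
  \<open>\<sigma> s\<^sub>1 \<dots> s\<^sub>k\<close>. The integral of \<open>K(z) F\<^sub>1(z) \<dots> F\<^sub>k(z) / z ^ q\<close> over large rectangles tends
  to \<open>0\<close>, so the sum of all residues vanishes. At \<open>n\<close> and \<open>-n\<close> the values of \<open>F\<^sub>i\<close> are, up to a
  common sign, \<open>c\<^sub>i + (-1) ^ p\<^sub>i s\<^sub>i h\<^sub>n\<close> and \<open>c\<^sub>i - h\<^sub>n\<close> with \<open>c\<^sub>i\<close> a sum of degree \<open>0\<close>; the parity
  condition says exactly that the two terms of degree \<open>k\<close> add up instead of cancelling.
  At a half-integer \<open>j - 1/2\<close> the kernel \<open>K\<close> is regular, so a residue uses the polar
  part of at least one \<open>F\<^sub>i\<close>, and only at most \<open>k - 1\<close> harmonic numbers \<open>H\<close> can remain. All other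
  contributions thus have degree less than \<open>k\<close>.
\<close>

unbundle fps_syntax

section \<open>Rational polynomials in a set of reals\<close>

text \<open>The plain digamma function would bring in Euler's constant, which has no reason to be a
  polynomial in Euler sums. Subtracting the value at \<open>1/2\<close> removes it: the normalised
  function is \<open>0\<close> at \<open>1/2\<close> and \<open>-2 ln 2\<close> at \<open>1\<close>,
  and \<open>ln 2\<close> is a sum of degree \<open>0\<close>. The kernel \<open>K\<close> is
  written through the same functions, so its coefficients are rational combinations of degree
  \<open>0\<close> sums and no evaluation in powers of \<pi> is needed. What remains is bookkeeping
  of degrees and of the exponent of the denominator; that exponent never drops below
  \<open>q\<close>, so \<open>(q, \<sigma>) \<noteq> (1, 1)\<close> secures convergence of every
  resulting series.

  The case \<open>q = 1\<close> shapes the contour. Up to logarithms the integrand is bounded by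
  \<open>1 / N\<close> on the sides \<open>|Re z| = N + 1/4\<close> and by \<open>1 / Y ^ 2\<close>
  on the sides \<open>|Im z| = Y\<close>, so supremum times length asks for
  \<open>sqrt N << Y << N\<close>. The offset \<open>1/4\<close> avoids both kinds of poles,
  integers and half-integers. The limit is taken along a subsequence of rectangles only, which
  suffices because the residue series are already known to converge.\<close>

lemma rat_polynomial_in_sum:
  fixes c :: "'i \<Rightarrow> rat" and \<mu> :: "'i \<Rightarrow> real multiset"
  assumes "finite I" and "\<And>i. i \<in> I \<Longrightarrow> set_mset (\<mu> i) \<subseteq> A"
  shows "rat_polynomial_in A (\<Sum>i\<in>I. of_rat (c i) * prod_mset (\<mu> i))"
proof -
  \<comment> \<open>Different indices may carry the same monomial, while the definition has one
    coefficient per multiset; hence the grouping by monomial.\<close>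
  have "(\<Sum>i\<in>I. of_rat (c i) * prod_mset (\<mu> i)) =
        (\<Sum>m\<in>\<mu> ` I. \<Sum>i\<in>{i\<in>I. \<mu> i = m}. of_rat (c i) * prod_mset (\<mu> i))"
    by (rule sum.image_gen[OF assms(1)])
  also have "\<dots> = (\<Sum>m\<in>\<mu> ` I. of_rat (\<Sum>i\<in>{i\<in>I. \<mu> i = m}. c i) * prod_mset m)"
    by (intro sum.cong refl) (simp add: of_rat_sum sum_distrib_right)
  finally show ?thesis
    using assms unfolding rat_polynomial_in_def
    by (intro exI[of _ "\<mu> ` I"] exI[of _ "\<lambda>m. \<Sum>i\<in>{i\<in>I. \<mu> i = m}. c i"]) auto
qed

lemma rat_polynomial_in_mem: "x \<in> A \<Longrightarrow> rat_polynomial_in A x"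
  using rat_polynomial_in_sum[of "{()}" "\<lambda>_. {#x#}" A "\<lambda>_. 1"] by simp

lemma rat_polynomial_in_of_rat: "rat_polynomial_in A (of_rat r)"
  using rat_polynomial_in_sum[of "{()}" "\<lambda>_. {#}" A "\<lambda>_. r"] by simp

text \<open>The disjoint union of the two sets of monomials serves as index set, so shared monomials
  need no case distinction. The product uses the Cartesian product in the same way.\<close>

lemma rat_polynomial_in_add:
  assumes "rat_polynomial_in A x" "rat_polynomial_in A y"
  shows "rat_polynomial_in A (x + y)"
proof -
  from assms obtain M c N d where
    M: "finite M" "\<forall>m\<in>M. set_mset m \<subseteq> A" "x = (\<Sum>m\<in>M. of_rat (c m) * prod_mset m)" and
    N: "finite N" "\<forall>m\<in>N. set_mset m \<subseteq> A" "y = (\<Sum>m\<in>N. of_rat (d m) * prod_mset m)"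
    unfolding rat_polynomial_in_def by metis
  have "x + y = (\<Sum>i\<in>M <+> N. of_rat (case_sum c d i) * prod_mset (case_sum id id i))"
    using M N by (subst sum.Plus) auto
  also have "rat_polynomial_in A \<dots>"
    using M N by (intro rat_polynomial_in_sum) auto
  finally show ?thesis .
qed

lemma rat_polynomial_in_mult:
  assumes "rat_polynomial_in A x" "rat_polynomial_in A y"
  shows "rat_polynomial_in A (x * y)"
proof -
  from assms obtain M c N d where
    M: "finite M" "\<forall>m\<in>M. set_mset m \<subseteq> A" "x = (\<Sum>m\<in>M. of_rat (c m) * prod_mset m)" and
    N: "finite N" "\<forall>m\<in>N. set_mset m \<subseteq> A" "y = (\<Sum>m\<in>N. of_rat (d m) * prod_mset m)"
    unfolding rat_polynomial_in_def by metis
  have "x * y = (\<Sum>i\<in>M \<times> N. of_rat (c (fst i) * d (snd i)) * prod_mset (fst i + snd i))"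
    using M N
    by (simp add: sum_product sum.cartesian_product of_rat_mult mult_ac case_prod_unfold)
  also have "rat_polynomial_in A \<dots>"
    using M N by (intro rat_polynomial_in_sum) auto
  finally show ?thesis .
qed

text \<open>Residues are complex, so polynomials in the real Euler sums are handled inside the
  complex numbers. Only these closure properties matter for coefficients of Laurent series.\<close>

locale rational_subalgebra =
  fixes W :: "complex set"
  assumes rat_mem: "of_rat r \<in> W"
    and add_mem: "x \<in> W \<Longrightarrow> y \<in> W \<Longrightarrow> x + y \<in> W"
    and mult_mem: "x \<in> W \<Longrightarrow> y \<in> W \<Longrightarrow> x * y \<in> W"
begin

lemma zero_mem: "0 \<in> W" and one_mem: "1 \<in> W"
  and of_int_mem: "of_int i \<in> W"
  using rat_mem[of 0] rat_mem[of 1] rat_mem[of "of_int i"] by auto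

lemma uminus_mem: "x \<in> W \<Longrightarrow> -x \<in> W"
  using mult_mem[of "of_int (-1)" x] of_int_mem[of "-1"] by simp

lemma diff_mem: "x \<in> W \<Longrightarrow> y \<in> W \<Longrightarrow> x - y \<in> W"
  using add_mem[of x "-y"] uminus_mem[of y] by simp

lemma sum_mem: "(\<And>i. i \<in> I \<Longrightarrow> f i \<in> W) \<Longrightarrow> sum f I \<in> W"
  by (induction I rule: infinite_finite_induct) (auto intro: zero_mem add_mem)

lemma power_mem: "x \<in> W \<Longrightarrow> x ^ n \<in> W"
  by (induction n) (auto intro: one_mem mult_mem)

lemma fls_times_mem:
  assumes "\<And>i. F $$ i \<in> W" "\<And>i. G $$ i \<in> W"
  shows "(F * G) $$ i \<in> W"
  unfolding fls_times_nth(2) by (intro sum_mem mult_mem assms)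

lemma fls_prod_mem:
  assumes "\<And>j i. j \<in> J \<Longrightarrow> F j $$ i \<in> W"
  shows "(\<Prod>j\<in>J. F j) $$ i \<in> W"
  using assms
  by (induction J arbitrary: i rule: infinite_finite_induct)
     (auto intro!: fls_times_mem intro: zero_mem one_mem simp: fls_one_nth)

end

lemma rational_subalgebra_polynomials:
  "rational_subalgebra (complex_of_real ` {x. rat_polynomial_in A x})" (is "rational_subalgebra ?W")
proof
  fix r :: rat and x y :: complex
  show "of_rat r \<in> ?W"
    using rat_polynomial_in_of_rat[of A r]
    by (intro image_eqI[of _ _ "of_rat r"]; cases r) (auto simp: of_rat_rat)
  show "x + y \<in> ?W" "x * y \<in> ?W" if "x \<in> ?W" "y \<in> ?W"
    using that rat_polynomial_in_add rat_polynomial_in_mult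
    by (auto simp flip: of_real_add of_real_mult)
qed

section \<open>Spans of products of harmonic numbers\<close>

definition valid_indices :: "(nat \<times> int) list \<Rightarrow> bool" where
  "valid_indices xs \<longleftrightarrow> (\<forall>(r, t)\<in>set xs. 1 \<le> r \<and> t \<in> {1, -1})"

text \<open>Both kinds of Euler sums share this bookkeeping: \<open>X\<close> and \<open>D\<close>
  become \<open>h_n\<close> and \<open>n\<close> for the S-sums, \<open>H_(n-1)\<close> and
  \<open>n - 1/2\<close> for the R-sums, with \<open>n = m + 1\<close>.\<close>

locale euler_span = rational_subalgebra +
  fixes X :: "nat \<Rightarrow> int \<Rightarrow> nat \<Rightarrow> complex" and D :: "nat \<Rightarrow> complex"
begin

definition mon :: "(nat \<times> int) list \<Rightarrow> nat \<Rightarrow> nat \<Rightarrow> complex" where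
  "mon xs u m = (\<Prod>(r, t)\<leftarrow>xs. X r t m) / D m ^ u"

text \<open>
  The bound on the number of factors is strict, so that \<open>E 0 u\<close> contains only the zero
  sequence.
\<close>

inductive E :: "nat \<Rightarrow> nat \<Rightarrow> (nat \<Rightarrow> complex) \<Rightarrow> bool" for d u where
  zero: "E d u (\<lambda>_. 0)"
| step: "E d u f \<Longrightarrow> w \<in> W \<Longrightarrow> length xs < d \<Longrightarrow> valid_indices xs \<Longrightarrow> u \<le> u' \<Longrightarrow>
          E d u (\<lambda>m. f m + w * mon xs u' m)"

lemma E_mon:
  "w \<in> W \<Longrightarrow> length xs < d \<Longrightarrow> valid_indices xs \<Longrightarrow> u \<le> u' \<Longrightarrow> E d u (\<lambda>m. w * mon xs u' m)"
  using step[OF zero] by simp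

lemma E_mono: "E d u f \<Longrightarrow> d \<le> d' \<Longrightarrow> v \<le> u \<Longrightarrow> E d' v f"
  by (induction rule: E.induct) (auto intro: E.intros)

lemma E_add: "E d u g \<Longrightarrow> E d u f \<Longrightarrow> E d u (\<lambda>m. f m + g m)"
proof (induction rule: E.induct)
  case (step g w xs u')
  then show ?case
    using E.step[of d u "\<lambda>m. f m + g m" w xs u'] by (simp add: add.assoc)
qed auto

lemma E_cmult: "E d u f \<Longrightarrow> w \<in> W \<Longrightarrow> E d u (\<lambda>m. w * f m)"
proof (induction rule: E.induct)
  case (step f w' xs u')
  then show ?case
    using E.step[of d u "\<lambda>m. w * f m" "w * w'" xs u']
    by (simp add: distrib_left mult.assoc mult_mem)
qed (use zero in auto)

lemma E_sum: "(\<And>i. i \<in> I \<Longrightarrow> E d u (f i)) \<Longrightarrow> E d u (\<lambda>m. \<Sum>i\<in>I. f i m)"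
proof (induction I rule: infinite_finite_induct)
  case (insert i I)
  then show ?case using E_add[of d u "\<lambda>m. \<Sum>i\<in>I. f i m" "f i"] by simp
qed (use zero in auto)

lemma mon_mult: "mon xs u m * mon ys v m = mon (xs @ ys) (u + v) m"
  by (simp add: mon_def power_add)

lemma E_mult_mon:
  assumes "E b v g" "w \<in> W" "length xs < a" "valid_indices xs" "u \<le> u'"
  shows "E (a + b - 1) (u + v) (\<lambda>m. w * mon xs u' m * g m)"
  using assms(1)
proof (induction rule: E.induct)
  case (step g w' ys v')
  have "E (a + b - 1) (u + v) (\<lambda>m. w * mon xs u' m * g m + (w * w') * mon (xs @ ys) (u' + v') m)"
    using step assms by (intro E.step) (auto intro: mult_mem simp: valid_indices_def)
  then show ?case
    by (simp add: distrib_left flip: mon_mult) (simp add: mult_ac)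
qed (use zero in auto)

text \<open>At most \<open>a - 1\<close> and at most \<open>b - 1\<close> factors combine to at most
  \<open>a + b - 2\<close>, which the strict bound records as \<open>a + b - 1\<close>. Truncated
  subtraction is harmless: if \<open>a\<close> or \<open>b\<close> is \<open>0\<close>, the product
  is the zero sequence.\<close>

lemma E_mult:
  assumes "E a u f" "E b v g"
  shows "E (a + b - 1) (u + v) (\<lambda>m. f m * g m)"
  using assms(1)
proof (induction rule: E.induct)
  case (step f w xs u')
  show ?case
    unfolding distrib_right
    by (intro E_add step.IH E_mult_mon[OF assms(2)] step.hyps)
qed (use zero in auto)

lemma E_const: "w \<in> W \<Longrightarrow> E (Suc d) 0 (\<lambda>_. w)"
  using E_mon[of w "[]" "Suc d" 0 0] by (simp add: mon_def valid_indices_def)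

lemma E_X: "1 \<le> r \<Longrightarrow> t \<in> {1, -1} \<Longrightarrow> E (Suc (Suc d)) 0 (X r t)"
  using E_mon[of 1 "[(r, t)]" "Suc (Suc d)" 0 0] by (simp add: mon_def valid_indices_def one_mem)

lemma E_inverse_power: "u \<le> v \<Longrightarrow> E (Suc d) u (\<lambda>m. 1 / D m ^ v)"
  using E_mon[of 1 "[]" "Suc d" u v] by (simp add: mon_def valid_indices_def one_mem)

text \<open>A member of \<open>E\<close> is a finite combination of monomials, so summing termwise
  reduces the claim to single monomials; \<open>z\<close> will be the sign \<sigma>.\<close>

lemma E_sums:
  assumes "E d u f"
    and "\<And>xs v. length xs < d \<Longrightarrow> valid_indices xs \<Longrightarrow> u \<le> v \<Longrightarrow>
           \<exists>x\<in>W. (\<lambda>m. z ^ m * mon xs v m) sums x"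
  shows "\<exists>x\<in>W. (\<lambda>m. z ^ m * f m) sums x"
  using assms(1)
proof (induction rule: E.induct)
  case zero
  then show ?case using zero_mem by auto
next
  case (step f w xs v)
  from step.IH obtain x where x: "x \<in> W" "(\<lambda>m. z ^ m * f m) sums x" by blast
  from assms(2)[of xs v] step.hyps obtain y where
    y: "y \<in> W" "(\<lambda>m. z ^ m * mon xs v m) sums y" by blast
  have "(\<lambda>m. z ^ m * f m + w * (z ^ m * mon xs v m)) sums (x + w * y)"
    by (intro sums_add sums_mult x y)
  moreover have "x + w * y \<in> W" by (intro add_mem mult_mem x y step.hyps)
  ultimately show ?case by (intro bexI[of _ "x + w * y"]) (simp_all add: algebra_simps)
qed

text \<open>
  Sequences of Laurent series whose regular coefficients have degree at most \<open>d\<close> and whose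
  polar coefficients have degree less than \<open>d\<close>. This class is multiplicative because
  a polar coefficient of a product uses a polar coefficient of one of the factors.
\<close>

definition L :: "nat \<Rightarrow> nat \<Rightarrow> (nat \<Rightarrow> complex fls) \<Rightarrow> bool" where
  "L d u A \<longleftrightarrow> (\<exists>P. \<forall>m. \<forall>i<P. A m $$ i = 0) \<and>
     (\<forall>i\<ge>0. E (Suc d) u (\<lambda>m. A m $$ i)) \<and> (\<forall>i<0. E d u (\<lambda>m. A m $$ i))"

lemma L_E: "L d u A \<Longrightarrow> E (Suc d) u (\<lambda>m. A m $$ i)"
  unfolding L_def by (cases "i < 0") (auto intro: E_mono)

lemma L_polar: "L d u A \<Longrightarrow> i < 0 \<Longrightarrow> E d u (\<lambda>m. A m $$ i)"
  unfolding L_def by auto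

text \<open>The general convolution formula sums over a range given by the subdegrees, which may
  vary with \<open>m\<close> in a sequence of series. Uniform bounds \<open>P\<close> and
  \<open>Q\<close> fix the range, as closure of \<open>E\<close> under finite sums requires.\<close>

lemma fls_times_nth_bounds:
  fixes F G :: "complex fls"
  assumes "\<And>i. i < P \<Longrightarrow> F $$ i = 0" "\<And>i. i < Q \<Longrightarrow> G $$ i = 0"
  shows "(F * G) $$ n = (\<Sum>i=P..n - Q. F $$ i * G $$ (n - i))"
proof (cases "F = 0 \<or> G = 0")
  case False
  then have "P \<le> fls_subdegree F" "Q \<le> fls_subdegree G"
    using assms by (meson fls_subdegree_geI)+
  then show ?thesis
    unfolding fls_times_nth(2) by (intro sum.mono_neutral_left) auto
qed auto

lemma L_mult:
  assumes "L a u A" "L b v B"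
  shows "L (a + b) (u + v) (\<lambda>m. A m * B m)"
proof -
  from assms obtain P Q where
    P: "\<And>m i. i < P \<Longrightarrow> A m $$ i = 0" and Q: "\<And>m i. i < Q \<Longrightarrow> B m $$ i = 0"
    unfolding L_def by blast
  have nth: "(A m * B m) $$ n = (\<Sum>i=P..n - Q. A m $$ i * B m $$ (n - i))" for m n
    by (rule fls_times_nth_bounds) (auto simp: P Q)
  have "E (Suc (a + b)) (u + v) (\<lambda>m. (A m * B m) $$ n)" for n
    unfolding nth using E_mult[OF L_E[OF assms(1)] L_E[OF assms(2)]] by (intro E_sum) simp
  moreover have "E (a + b) (u + v) (\<lambda>m. (A m * B m) $$ n)" if n: "n < 0" for n
    unfolding nth
  proof (intro E_sum)
    fix i
    consider "i < 0" | "n - i < 0" using n by linarith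
    then show "E (a + b) (u + v) (\<lambda>m. A m $$ i * B m $$ (n - i))"
    proof cases
      case 1
      then show ?thesis using E_mult[OF L_polar[OF assms(1) 1] L_E[OF assms(2), of "n - i"]] by simp
    next
      case 2
      then show ?thesis using E_mult[OF L_E[OF assms(1), of i] L_polar[OF assms(2) 2]] by simp
    qed
  qed
  moreover have "(A m * B m) $$ i = 0" if "i < P + Q" for m i
    unfolding nth using that by simp
  ultimately show ?thesis unfolding L_def by blast
qed

lemma L_one: "L 0 0 (\<lambda>_. 1)"
  unfolding L_def by (auto simp: fls_one_nth intro!: E_const zero one_mem exI[of _ 0])

lemma L_prod:
  assumes "finite I" "\<And>i. i \<in> I \<Longrightarrow> L 1 0 (A i)"
  shows "L (card I) 0 (\<lambda>m. \<Prod>i\<in>I. A i m)"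
  using assms
proof (induction I rule: finite_induct)
  case (insert i I)
  then show ?case using L_mult[of 1 0 "A i" "card I" 0 "\<lambda>m. \<Prod>i\<in>I. A i m"] by simp
qed (simp add: L_one)

end

section \<open>Signed Hurwitz series\<close>

text \<open>For \<open>p \<ge> 2\<close> this is the Hurwitz zeta value, the sum of
  \<open>1 / (z + j) ^ p\<close> over \<open>j \<ge> 0\<close>; for \<open>p = 1\<close> it is
  \<open>- Digamma z\<close>.\<close>

definition hurwitz_sum :: "nat \<Rightarrow> complex \<Rightarrow> complex" where
  "hurwitz_sum p z = (-1) ^ p / fact (p - 1) * Polygamma (p - 1) z"

text \<open>
  The function \<open>\<Sum>j\<ge>0. t ^ j / (z + j) ^ p\<close> for \<open>t = 1\<close> and \<open>t = -1\<close>. In the divergent case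
  \<open>p = t = 1\<close> it is normalised to vanish at \<open>1/2\<close>.
\<close>

definition lerch :: "nat \<Rightarrow> int \<Rightarrow> complex \<Rightarrow> complex" where
  "lerch p t z =
     (if t = 1 then hurwitz_sum p z - (if p = 1 then hurwitz_sum 1 (1/2) else 0)
      else (hurwitz_sum p (z / 2) - hurwitz_sum p ((z + 1) / 2)) / 2 ^ p)"

lemma hurwitz_sum_plus1:
  assumes "z \<noteq> 0" "1 \<le> p"
  shows "hurwitz_sum p z = 1 / z ^ p + hurwitz_sum p (z + 1)"
proof -
  obtain n where "p = Suc n" using assms(2) by (cases p) auto
  moreover have "(-1) ^ n * (-1) ^ n = (1 :: complex)" by (simp flip: power_add)
  ultimately show ?thesis
    using Polygamma_plus1[OF assms(1), of n] by (simp add: hurwitz_sum_def field_simps)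
qed

text \<open>For \<open>t = 1\<close> the normalising constant is the same on both sides. For
  \<open>t = -1\<close> the shift swaps the even and odd halves of the series, so the recurrence is
  only needed at \<open>z / 2\<close>.\<close>

lemma lerch_plus1:
  assumes "z \<noteq> 0" "1 \<le> p" "t \<in> {1, -1}"
  shows "lerch p t z = 1 / z ^ p + of_int t * lerch p t (z + 1)"
  using assms hurwitz_sum_plus1[of z p] hurwitz_sum_plus1[of "z / 2" p]
  by (auto simp: lerch_def field_simps power_divide)

lemma half_nonpos_Ints:
  fixes z :: complex
  assumes "z \<notin> \<int>\<^sub>\<le>\<^sub>0"
  shows "z / 2 \<notin> \<int>\<^sub>\<le>\<^sub>0" "(z + 1) / 2 \<notin> \<int>\<^sub>\<le>\<^sub>0"
proof -
  show "z / 2 \<notin> \<int>\<^sub>\<le>\<^sub>0"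
  proof
    assume "z / 2 \<in> \<int>\<^sub>\<le>\<^sub>0"
    then obtain n where "z / 2 = - of_nat n" by (elim nonpos_Ints_cases')
    then have "z = - of_nat (2 * n)" by (simp add: field_simps)
    with assms show False by (metis minus_of_nat_in_nonpos_Ints)
  qed
  show "(z + 1) / 2 \<notin> \<int>\<^sub>\<le>\<^sub>0"
  proof
    assume "(z + 1) / 2 \<in> \<int>\<^sub>\<le>\<^sub>0"
    then obtain n where "(z + 1) / 2 = - of_nat n" by (elim nonpos_Ints_cases')
    moreover have "z = (z + 1) / 2 * 2 - 1" by (simp add: field_simps)
    ultimately have "z = - of_nat (2 * n + 1)" by simp
    with assms show False by (metis minus_of_nat_in_nonpos_Ints)
  qed
qed

lemma has_field_derivative_hurwitz_sum:
  assumes "z \<notin> \<int>\<^sub>\<le>\<^sub>0" "1 \<le> p"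
  shows "(hurwitz_sum p has_field_derivative - of_nat p * hurwitz_sum (Suc p) z) (at z)"
proof -
  obtain n where p: "p = Suc n" using assms(2) by (cases p) auto
  have "((\<lambda>z. (-1) ^ Suc n / fact n * Polygamma n z) has_field_derivative
         (-1) ^ Suc n / fact n * Polygamma (Suc n) z) (at z)"
    using assms(1) by (auto intro!: derivative_eq_intros)
  also have "(-1) ^ Suc n / fact n * Polygamma (Suc n) z = - of_nat p * hurwitz_sum (Suc p) z"
    by (simp add: hurwitz_sum_def p divide_simps del: of_nat_Suc)
  finally show ?thesis by (simp add: hurwitz_sum_def[abs_def] p)
qed

text \<open>Differentiation only raises \<open>p\<close>, and the normalising constant disappears;
  hence all Taylor coefficients are rational multiples of values of the same family.\<close>

lemma has_field_derivative_lerch: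
  assumes "z \<notin> \<int>\<^sub>\<le>\<^sub>0" "1 \<le> p"
  shows "(lerch p t has_field_derivative - of_nat p * lerch (Suc p) t z) (at z)"
proof (cases "t = 1")
  case True
  have "((\<lambda>z. hurwitz_sum p z - (if p = 1 then hurwitz_sum 1 (1/2) else 0)) has_field_derivative
         - of_nat p * hurwitz_sum (Suc p) z - 0) (at z)"
    by (intro DERIV_diff has_field_derivative_hurwitz_sum[OF assms] DERIV_const)
  then show ?thesis using True assms(2) by (simp add: lerch_def[abs_def])
next
  case False
  have 1: "((\<lambda>z. hurwitz_sum p (z / 2)) has_field_derivative
         (- of_nat p * hurwitz_sum (Suc p) (z / 2)) * (1 / 2)) (at z)"
    by (rule DERIV_chain2[OF has_field_derivative_hurwitz_sum DERIV_cdivide[OF DERIV_ident]])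
       (use assms half_nonpos_Ints in auto)
  have 2: "((\<lambda>z. hurwitz_sum p ((z + 1) / 2)) has_field_derivative
         (- of_nat p * hurwitz_sum (Suc p) ((z + 1) / 2)) * (1 / 2)) (at z)"
    using DERIV_chain2[OF has_field_derivative_hurwitz_sum
        DERIV_cdivide[OF DERIV_add[OF DERIV_ident DERIV_const]], of z 1 2 p] assms half_nonpos_Ints
    by simp
  show ?thesis
    using DERIV_cdivide[OF DERIV_diff[OF 1 2], of "2 ^ p"] False
    by (simp add: lerch_def[abs_def] field_simps)
qed

lemma open_Compl_nonpos_Ints: "open (- \<int>\<^sub>\<le>\<^sub>0 :: complex set)"
  by (simp add: open_Compl)

lemma holomorphic_on_lerch:
  assumes "1 \<le> p"
  shows "lerch p t holomorphic_on - \<int>\<^sub>\<le>\<^sub>0"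
  using has_field_derivative_lerch[OF _ assms] open_Compl_nonpos_Ints
  by (subst holomorphic_on_open) auto

lemma holomorphic_on_lerch' [holomorphic_intros]:
  assumes "f holomorphic_on A" "1 \<le> p" "\<And>z. z \<in> A \<Longrightarrow> f z \<notin> \<int>\<^sub>\<le>\<^sub>0"
  shows "(\<lambda>z. lerch p t (f z)) holomorphic_on A"
  using holomorphic_on_compose_gen[OF assms(1) holomorphic_on_lerch[OF assms(2)]] assms(3)
  by (auto simp: o_def)

text \<open>In the difference of two Digamma series the comparison terms \<open>1 / (k + 1)\<close>
  and Euler's constant cancel.\<close>

lemma sums_lerch_1_1:
  assumes "z \<noteq> 0"
  shows "(\<lambda>k. 1 / (z + of_nat k) - 1 / (1 / 2 + of_nat k)) sums lerch 1 1 z"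
proof -
  have *: "(\<lambda>k. inverse (of_nat (Suc k)) - inverse (w + of_nat k)) sums (Digamma w + euler_mascheroni)"
    if "w \<noteq> 0" for w :: complex
    using summable_sums[OF summable_Digamma[OF that]] by (simp add: Digamma_def)
  have "(\<lambda>k. (inverse (of_nat (Suc k)) - inverse (1 / 2 + of_nat k)) -
             (inverse (of_nat (Suc k)) - inverse (z + of_nat k))) sums
        ((Digamma (1 / 2) + euler_mascheroni) - (Digamma z + euler_mascheroni))"
    by (intro sums_diff *) (use assms in auto)
  then show ?thesis by (simp add: lerch_def hurwitz_sum_def inverse_eq_divide)
qed

lemma sums_lerch_1:
  assumes "z \<noteq> 0" "2 \<le> p"
  shows "(\<lambda>k. 1 / (z + of_nat k) ^ p) sums lerch p 1 z"
proof -
  obtain n where p: "p = Suc n" "n \<noteq> 0" using assms(2) by (cases p) auto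
  have "(-1) ^ n * (-1) ^ n = (1 :: complex)" by (simp flip: power_add)
  then show ?thesis
    using summable_sums[OF Polygamma_converges'[OF assms]] assms(2)
    by (simp add: lerch_def hurwitz_sum_def Polygamma_def p inverse_eq_divide del: power_Suc)
qed

text \<open>Consecutive terms are paired because for \<open>p = 1\<close> neither half of the
  alternating series converges by itself; the normalising constants of the halves cancel in the
  difference.\<close>

lemma sums_lerch_neg:
  assumes "z \<noteq> 0" "z \<noteq> -1" "1 \<le> p"
  shows "(\<lambda>k. 1 / (z + of_nat (2 * k)) ^ p - 1 / (z + of_nat (2 * k + 1)) ^ p) sums lerch p (-1) z"
proof -
  have nz: "z / 2 \<noteq> 0" "(z + 1) / 2 \<noteq> 0"
    using assms by (auto simp: eq_neg_iff_add_eq_0)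
  have *: "(\<lambda>k. 1 / (z / 2 + of_nat k) ^ p - 1 / ((z + 1) / 2 + of_nat k) ^ p) sums
        (hurwitz_sum p (z / 2) - hurwitz_sum p ((z + 1) / 2))"
  proof (cases "p = 1")
    case True
    then show ?thesis
      using sums_diff[OF sums_lerch_1_1[OF nz(1)] sums_lerch_1_1[OF nz(2)]]
      by (simp add: lerch_def)
  next
    case False
    then have "2 \<le> p" using assms by simp
    then show ?thesis
      using sums_diff[OF sums_lerch_1[OF nz(1)] sums_lerch_1[OF nz(2)]]
      by (simp add: lerch_def)
  qed
  have "1 / (z / 2 + of_nat k) ^ p / 2 ^ p = 1 / (z + of_nat (2 * k)) ^ p"
       "1 / ((z + 1) / 2 + of_nat k) ^ p / 2 ^ p = 1 / (z + of_nat (2 * k + 1)) ^ p" for k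
  proof -
    have "(z / 2 + of_nat k) * 2 = z + of_nat (2 * k)"
         "((z + 1) / 2 + of_nat k) * 2 = z + of_nat (2 * k + 1)" by (simp_all add: algebra_simps)
    then show "1 / (z / 2 + of_nat k) ^ p / 2 ^ p = 1 / (z + of_nat (2 * k)) ^ p"
       "1 / ((z + 1) / 2 + of_nat k) ^ p / 2 ^ p = 1 / (z + of_nat (2 * k + 1)) ^ p"
      by (metis divide_divide_eq_left power_mult_distrib)+
  qed
  then show ?thesis
    using sums_divide[OF *, of "2 ^ p"] by (simp add: lerch_def diff_divide_distrib)
qed

lemma summable_lerch_real:
  assumes "0 < x" "1 \<le> p" "t \<in> {1, -1 :: int}" "(p, t) \<noteq> (1, 1)"
  shows "summable (\<lambda>j. of_int t ^ j / (x + real j) ^ p)"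
proof (cases "t = 1")
  case True
  then have "2 \<le> p" using assms by auto
  then have "summable (\<lambda>j. inverse ((x + real j) ^ p))"
    using assms(1) by (intro Polygamma_converges') auto
  then show ?thesis using True by (simp add: inverse_eq_divide)
next
  case False
  then have t: "t = -1" using assms by simp
  have "(\<lambda>j. 1 / (x + real j)) \<longlonglongrightarrow> 0" by real_asymp
  then have lim: "(\<lambda>j. 1 / (x + real j) ^ p) \<longlonglongrightarrow> 0"
    using assms(2) tendsto_power[of "\<lambda>j. 1 / (x + real j)" 0 sequentially p]
    by (simp add: power_divide power_0_left split: if_splits)
  have "decseq (\<lambda>j. 1 / (x + real j) ^ p)"
    using assms(1) by (intro decseq_SucI divide_left_mono power_mono) auto
  then have "summable (\<lambda>j. (-1) ^ j * (1 / (x + real j) ^ p))"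
    by (intro summable_Leibniz(1) lim decseq_imp_monoseq)
  then show ?thesis by (simp add: t)
qed

lemma lerch_of_real:
  assumes "0 < x" "1 \<le> p" "t \<in> {1, -1 :: int}" "(p, t) \<noteq> (1, 1)"
  shows "lerch p t (of_real x) = of_real (\<Sum>j. of_int t ^ j / (x + real j) ^ p)"
proof -
  have s: "(\<lambda>j. complex_of_real (of_int t ^ j / (x + real j) ^ p)) sums
           of_real (\<Sum>j. of_int t ^ j / (x + real j) ^ p)"
    by (intro sums_of_real summable_sums summable_lerch_real assms)
  show ?thesis
  proof (cases "t = 1")
    case True
    then have "2 \<le> p" using assms by auto
    then show ?thesis
      using sums_unique2[OF s] sums_lerch_1[of "of_real x" p] True assms(1) by simp
  next
    case False
    then have t: "t = -1" using assms by simp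
    have ne: "complex_of_real x \<noteq> -1"
      using assms(1) by (auto simp: complex_eq_iff)
    \<comment> \<open>A convergent series may be grouped in blocks of two, which gives the paired
      form of \<open>sums_lerch_neg\<close>.\<close>
    have "{n * 2..<n * 2 + 2} = {2 * n, 2 * n + 1}" for n :: nat by auto
    then have "(\<lambda>k. 1 / (complex_of_real x + of_nat (2 * k)) ^ p -
                   1 / (of_real x + of_nat (2 * k + 1)) ^ p) sums
          of_real (\<Sum>j. of_int t ^ j / (x + real j) ^ p)"
      using sums_group[OF s, of 2] by (simp add: t)
    then show ?thesis
      using sums_unique2[OF sums_lerch_neg[of "of_real x" p]] ne assms t by simp
  qed
qed

lemma lerch_1_1_half: "lerch 1 1 (1 / 2) = 0"
  by (simp add: lerch_def)

text \<open>Digamma is \<open>-\<gamma>\<close> at \<open>1\<close> and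
  \<open>-\<gamma> - 2 ln 2\<close> at \<open>1/2\<close>, with Euler's constant \<gamma>. Only
  \<open>ln 2\<close> survives, an alternating sum of degree \<open>0\<close>.\<close>

lemma lerch_1_1_1: "lerch 1 1 1 = - 2 * of_real (ln 2)"
  by (simp add: lerch_def hurwitz_sum_def Digamma_one_half)

section \<open>Taylor expansions\<close>

text \<open>The relation \<open>g p' = - p * g (p + 1)\<close> determines all higher derivatives of
  \<open>g p\<close>. It holds both for \<open>lerch\<close> and for \<open>1 / z ^ p\<close>, so
  one induction serves both expansions.\<close>

lemma has_fps_expansion_negative_power_family:
  fixes g :: "nat \<Rightarrow> complex \<Rightarrow> complex"
  assumes "open S"
    and "\<And>p z. 1 \<le> p \<Longrightarrow> z \<in> S \<Longrightarrow>
           (g p has_field_derivative - of_nat p * g (Suc p) z) (at z)"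
    and "z \<in> S" "1 \<le> p"
  shows "(\<lambda>x. g p (z + x)) has_fps_expansion
           Abs_fps (\<lambda>r. (-1) ^ r * pochhammer (of_nat p) r / fact r * g (p + r) z)"
proof -
  have "(deriv ^^ r) (g p) w = (-1) ^ r * pochhammer (of_nat p) r * g (p + r) w" if "w \<in> S" for r w
    using that
  proof (induction r arbitrary: w)
    case (Suc r)
    have "((deriv ^^ r) (g p) has_field_derivative
           (-1) ^ r * pochhammer (of_nat p) r * (- of_nat (p + r) * g (Suc (p + r)) w)) (at w)"
      by (rule has_field_derivative_transform_within_open[OF DERIV_cmult[OF assms(2)] assms(1)])
         (use assms Suc in auto)
    then show ?case
      by (simp add: DERIV_imp_deriv pochhammer_Suc algebra_simps)
  qed simp
  note higher = this
  have "g p holomorphic_on S"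
    using assms by (subst holomorphic_on_open) auto
  then have "g p analytic_on {z}"
    using assms by (meson analytic_at)
  then have "(\<lambda>x. g p (z + x)) has_fps_expansion fps_expansion (g p) z"
    by (rule analytic_at_imp_has_fps_expansion)
  also have "fps_expansion (g p) z =
      Abs_fps (\<lambda>r. (-1) ^ r * pochhammer (of_nat p) r / fact r * g (p + r) z)"
    unfolding fps_expansion_def by (intro arg_cong[of _ _ Abs_fps] ext) (simp add: higher assms)
  finally show ?thesis .
qed

lemma has_fps_expansion_lerch:
  assumes "z \<notin> \<int>\<^sub>\<le>\<^sub>0" "1 \<le> p"
  shows "(\<lambda>x. lerch p t (z + x)) has_fps_expansion
           Abs_fps (\<lambda>r. (-1) ^ r * pochhammer (of_nat p) r / fact r * lerch (p + r) t z)"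
  using assms
  by (intro has_fps_expansion_negative_power_family[OF open_Compl_nonpos_Ints]
        has_field_derivative_lerch) auto

lemma has_fps_expansion_inverse_power:
  fixes z :: complex
  assumes "z \<noteq> 0" "1 \<le> p"
  shows "(\<lambda>x. 1 / (z + x) ^ p) has_fps_expansion
           Abs_fps (\<lambda>r. (-1) ^ r * pochhammer (of_nat p) r / fact r * (1 / z ^ (p + r)))"
proof (rule has_fps_expansion_negative_power_family[of "- {0}" "\<lambda>p z. 1 / z ^ p"])
  fix p :: nat and z :: complex
  assume "1 \<le> p" "z \<in> - {0}"
  then obtain n where p: "p = Suc n" and z: "z \<noteq> 0" by (cases p) auto
  show "((\<lambda>z. 1 / z ^ p) has_field_derivative - of_nat p * (1 / z ^ Suc p)) (at z)"
    by (rule DERIV_cong[OF DERIV_inverse_fun[OF DERIV_power_Suc[OF DERIV_ident, where n = n],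
            folded p, unfolded inverse_eq_divide]])
       (use z in \<open>auto simp: p field_simps\<close>)
qed (use assms in auto)

section \<open>Growth of the signed Hurwitz series\<close>

text \<open>Besides keeping \<open>z\<close> off the integers, the bound grows linearly with
  \<open>|Im z|\<close> and with the index counted from the integer nearest to the pole, up to
  rounding. The factor \<open>1/16\<close> absorbs that rounding and a minimal distance of
  \<open>1/4\<close>.\<close>

definition away_from_Ints :: "complex \<Rightarrow> bool" where
  "away_from_Ints z \<longleftrightarrow>
     (\<forall>m::int. (1 + \<bar>Im z\<bar> + \<bar>of_int (m + \<lfloor>Re z\<rfloor>)\<bar>) / 16 \<le> cmod (z + of_int m))"

lemma away_from_IntsI:
  assumes "(\<forall>m::int. 1 / 4 \<le> \<bar>Re z + of_int m\<bar>) \<or> 1 \<le> \<bar>Im z\<bar>"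
  shows "away_from_Ints z"
  unfolding away_from_Ints_def
proof
  fix m :: int
  have "\<bar>real_of_int (m + \<lfloor>Re z\<rfloor>)\<bar> \<le> 1 + \<bar>Re z + of_int m\<bar>"
    by linarith
  moreover have "\<bar>Re z + of_int m\<bar> \<le> cmod (z + of_int m)" "\<bar>Im z\<bar> \<le> cmod (z + of_int m)"
    using abs_Re_le_cmod[of "z + of_int m"] abs_Im_le_cmod[of "z + of_int m"] by simp_all
  moreover from this have "1 / 4 \<le> cmod (z + of_int m)"
    using assms by (elim disjE) (use order_trans in blast, linarith)
  moreover have "(1 + y + a) / 16 \<le> M" if "a \<le> 1 + x" "x \<le> M" "y \<le> M" "1 / 4 \<le> M"
    for a x y M :: real using that by (simp add: field_simps)
  ultimately show "(1 + \<bar>Im z\<bar> + \<bar>of_int (m + \<lfloor>Re z\<rfloor>)\<bar>) / 16 \<le> cmod (z + of_int m)"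
    by blast
qed

lemma away_from_Ints_bound:
  assumes "away_from_Ints z"
  shows "(1 + \<bar>Im z\<bar> + real (nat \<bar>int i + \<lfloor>Re z\<rfloor>\<bar>)) / 16 \<le> cmod (z + of_nat i)"
  using assms[unfolded away_from_Ints_def, rule_format, of "int i"] by simp

lemma away_from_Ints_ge:
  assumes "away_from_Ints z"
  shows "1 / 16 \<le> cmod (z + of_nat i)"
  using away_from_Ints_bound[OF assms, of i] by (smt (verit) divide_right_mono of_nat_0_le_iff)

text \<open>The values \<open>|i + a|\<close> first decrease to \<open>0\<close> or stop, then
  increase. Each of the two monotone stretches is dominated by an initial segment of \<phi>, which
  gives the factor \<open>2\<close>.\<close>

lemma sum_antimono_shift_le:
  fixes \<phi> :: "nat \<Rightarrow> real" and a :: int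
  assumes "antimono \<phi>" "\<And>i. 0 \<le> \<phi> i"
  shows "(\<Sum>i<n. \<phi> (nat \<bar>int i + a\<bar>)) \<le> 2 * (\<Sum>i<n. \<phi> i)"
proof (cases "0 \<le> a")
  case True
  have "(\<Sum>i<n. \<phi> (nat \<bar>int i + a\<bar>)) \<le> (\<Sum>i<n. \<phi> i)"
    using True by (intro sum_mono antimonoD[OF assms(1)]) auto
  moreover have "0 \<le> (\<Sum>i<n. \<phi> i)" by (intro sum_nonneg assms)
  ultimately show ?thesis by simp
next
  case False
  define b where "b = nat (- a)"
  have a: "a = - int b" using False by (simp add: b_def)
  define c where "c = min b n"
  have split: "{..<n} = {..<c} \<union> {c..<n}" by (auto simp: c_def)
  have "(\<Sum>i<n. \<phi> (nat \<bar>int i + a\<bar>)) =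
        (\<Sum>i<c. \<phi> (nat \<bar>int i + a\<bar>)) + (\<Sum>i=c..<n. \<phi> (nat \<bar>int i + a\<bar>))"
    unfolding split by (intro sum.union_disjoint) auto
  also have "(\<Sum>i<c. \<phi> (nat \<bar>int i + a\<bar>)) \<le> (\<Sum>i<c. \<phi> (c - Suc i))"
    by (intro sum_mono antimonoD[OF assms(1)]) (auto simp: a c_def)
  also have "(\<Sum>i<c. \<phi> (c - Suc i)) = (\<Sum>i<c. \<phi> i)"
    by (rule sum.nat_diff_reindex)
  also have "\<dots> \<le> (\<Sum>i<n. \<phi> i)"
    by (intro sum_mono2 assms) (auto simp: c_def)
  also have "(\<Sum>i=c..<n. \<phi> (nat \<bar>int i + a\<bar>)) = (\<Sum>i=c..<n. \<phi> (i - c))"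
    by (intro sum.cong arg_cong[of _ _ \<phi>]) (auto simp: a c_def)
  also have "\<dots> = (\<Sum>i<n - c. \<phi> i)"
    by (rule sum.reindex_bij_witness[of _ "\<lambda>i. i + c" "\<lambda>i. i - c"]) auto
  also have "\<dots> \<le> (\<Sum>i<n. \<phi> i)"
    by (intro sum_mono2 assms) auto
  finally show ?thesis by simp
qed

lemma sum_inverse_squares_le:
  fixes Y :: real
  assumes "1 \<le> Y"
  shows "(\<Sum>j<n. 1 / (Y + real j)\<^sup>2) \<le> 2 / Y"
proof -
  \<comment> \<open>The sharper right-hand side telescopes and makes the induction work.\<close>
  have "(\<Sum>j<n. 1 / (Y + real j)\<^sup>2) \<le> 2 / Y - 2 / (Y + real n)"
  proof (induction n)
    case (Suc n)
    define c where "c = Y + real n"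
    have c: "1 \<le> c" using assms by (simp add: c_def)
    have "1 / c\<^sup>2 \<le> 2 / c - 2 / (c + 1)"
    proof -
      have "2 / c - 2 / (c + 1) = 2 / (c * (c + 1))" using c by (simp add: divide_simps)
      also have "1 / c\<^sup>2 \<le> \<dots>"
        using c by (simp add: divide_simps power2_eq_square)
      finally show ?thesis .
    qed
    then show ?case using Suc by (simp add: c_def add_ac)
  qed simp
  also have "\<dots> \<le> 2 / Y" using assms by simp
  finally show ?thesis .
qed

text \<open>The constant is \<open>16 ^ 2\<close> from the distance bound, times \<open>2\<close>
  for the two directions, times \<open>2\<close> from the telescoping estimate.\<close>

lemma sum_inverse_squares_away:
  assumes "away_from_Ints z"
  shows "(\<Sum>i<n. 1 / (cmod (z + of_nat i))\<^sup>2) \<le> 1024 / (1 + \<bar>Im z\<bar>)"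
proof -
  define Y where "Y = 1 + \<bar>Im z\<bar>"
  define \<phi> where "\<phi> = (\<lambda>j::nat. 1 / (Y + real j)\<^sup>2)"
  have Y: "1 \<le> Y" by (simp add: Y_def)
  have "1 / (cmod (z + of_nat i))\<^sup>2 \<le> 256 * \<phi> (nat \<bar>int i + \<lfloor>Re z\<rfloor>\<bar>)" for i
  proof -
    define u where "u = Y + real (nat \<bar>int i + \<lfloor>Re z\<rfloor>\<bar>)"
    have "0 < u" "u / 16 \<le> cmod (z + of_nat i)"
      using away_from_Ints_bound[OF assms, of i] by (auto simp: u_def Y_def)
    then have "1 / (cmod (z + of_nat i))\<^sup>2 \<le> 1 / (u / 16)\<^sup>2"
      by (intro divide_left_mono power_mono) (auto intro!: mult_pos_pos)
    then show ?thesis by (simp add: \<phi>_def u_def power_divide)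
  qed
  then have "(\<Sum>i<n. 1 / (cmod (z + of_nat i))\<^sup>2) \<le>
        256 * (\<Sum>i<n. \<phi> (nat \<bar>int i + \<lfloor>Re z\<rfloor>\<bar>))"
    unfolding sum_distrib_left by (intro sum_mono)
  also have "(\<Sum>i<n. \<phi> (nat \<bar>int i + \<lfloor>Re z\<rfloor>\<bar>)) \<le> 2 * (\<Sum>i<n. \<phi> i)"
    by (rule sum_antimono_shift_le)
       (use Y in \<open>auto simp: \<phi>_def antimono_def intro!: divide_left_mono power_mono\<close>)
  also have "(\<Sum>i<n. \<phi> i) \<le> 2 / Y"
    unfolding \<phi>_def by (rule sum_inverse_squares_le[OF Y])
  finally show ?thesis by (simp add: Y_def)
qed

lemma sum_inverses_away:
  assumes "away_from_Ints z"
  shows "(\<Sum>i<n. 1 / cmod (z + of_nat i)) \<le> 32 * harm n"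
proof -
  define \<phi> where "\<phi> = (\<lambda>j::nat. 1 / (1 + real j))"
  have "1 / cmod (z + of_nat i) \<le> 16 * \<phi> (nat \<bar>int i + \<lfloor>Re z\<rfloor>\<bar>)" for i
  proof -
    define u where "u = 1 + real (nat \<bar>int i + \<lfloor>Re z\<rfloor>\<bar>)"
    have "0 < u" "u / 16 \<le> cmod (z + of_nat i)"
      using away_from_Ints_bound[OF assms, of i] by (auto simp: u_def)
    then have "1 / cmod (z + of_nat i) \<le> 1 / (u / 16)"
      by (intro divide_left_mono) (auto intro!: mult_pos_pos)
    then show ?thesis by (simp add: \<phi>_def u_def)
  qed
  then have "(\<Sum>i<n. 1 / cmod (z + of_nat i)) \<le> 16 * (\<Sum>i<n. \<phi> (nat \<bar>int i + \<lfloor>Re z\<rfloor>\<bar>))"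
    unfolding sum_distrib_left by (intro sum_mono)
  also have "(\<Sum>i<n. \<phi> (nat \<bar>int i + \<lfloor>Re z\<rfloor>\<bar>)) \<le> 2 * (\<Sum>i<n. \<phi> i)"
    by (rule sum_antimono_shift_le) (auto simp: \<phi>_def antimono_def intro!: divide_left_mono)
  also have "(\<Sum>i<n. \<phi> i) = harm n"
    by (simp add: \<phi>_def harm_altdef inverse_eq_divide add_ac)
  finally show ?thesis by simp
qed

lemma norm_sums_le:
  assumes "f sums s" "\<And>n. norm (\<Sum>i<n. f i) \<le> B"
  shows "norm s \<le> B"
  using assms unfolding sums_def by (intro LIMSEQ_le_const2[OF tendsto_norm]) auto

lemma inverse_power_away_le:
  assumes "away_from_Ints z" "2 \<le> p"
  shows "1 / cmod (z + of_nat i) ^ p \<le> 16 ^ p * (1 / (cmod (z + of_nat i))\<^sup>2)"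
proof -
  define a where "a = cmod (z + of_nat i)"
  have a: "1 / 16 \<le> a" using away_from_Ints_ge[OF assms(1)] by (simp add: a_def)
  have "1 / a ^ (p - 2) \<le> 1 / (1 / 16) ^ (p - 2)"
    using a by (intro divide_left_mono power_mono) auto
  also have "\<dots> \<le> 16 ^ p" by (simp add: power_divide)
  finally have "1 / a ^ (p - 2) * (1 / a\<^sup>2) \<le> 16 ^ p * (1 / a\<^sup>2)"
    by (intro mult_right_mono) auto
  also have "1 / a ^ (p - 2) * (1 / a\<^sup>2) = 1 / a ^ p"
  proof -
    have "a ^ p = a ^ (p - 2) * a\<^sup>2"
      using assms(2) by (metis le_add_diff_inverse2 power_add)
    then show ?thesis by simp
  qed
  finally show ?thesis by (simp add: a_def)
qed

text \<open>Everything reduces to the sum of inverse squares. In the critical case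
  \<open>p = 1\<close>, \<open>t = -1\<close> two paired terms combine to
  \<open>1 / ((z + i) * (z + i + 1))\<close>, and a product is at most a combination of
  squares.\<close>

lemma norm_lerch_le:
  assumes z: "away_from_Ints z" and p: "1 \<le> p" and t: "t \<in> {1, -1}" and "(p, t) \<noteq> (1, 1)"
  shows "cmod (lerch p t z) \<le> 16 ^ p * 1024 / (1 + \<bar>Im z\<bar>)"
proof -
  have ne: "z + of_nat i \<noteq> 0" for i
    using away_from_Ints_ge[OF z, of i] by auto
  define q where "q = (\<lambda>i. 1 / (cmod (z + of_nat i))\<^sup>2)"
  have q: "(\<Sum>i<n. 16 ^ p * q i) \<le> 16 ^ p * 1024 / (1 + \<bar>Im z\<bar>)" for n
    using mult_left_mono[OF sum_inverse_squares_away[OF z, of n], of "16 ^ p"]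
    by (simp add: q_def sum_distrib_left)
  show ?thesis
  proof (cases "t = 1")
    case True
    then have p2: "2 \<le> p" using assms by auto
    have "cmod (\<Sum>i<n. 1 / (z + of_nat i) ^ p) \<le> (\<Sum>i<n. 16 ^ p * q i)" for n
      unfolding q_def using inverse_power_away_le[OF z p2]
      by (intro sum_norm_le) (simp add: norm_divide norm_power)
    then have "cmod (\<Sum>i<n. 1 / (z + of_nat i) ^ p) \<le> 16 ^ p * 1024 / (1 + \<bar>Im z\<bar>)" for n
      using q order_trans by blast
    from norm_sums_le[OF sums_lerch_1[of z p] this] show ?thesis
      using p2 ne[of 0] True by simp
  next
    case False
    then have t: "t = -1" using t by simp
    have *: "cmod (1 / (z + of_nat i) ^ p - 1 / (z + of_nat (i + 1)) ^ p) \<le>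
          16 ^ p * q i + 16 ^ p * q (i + 1)" for i
    proof (cases "p = 1")
      case True
      define a b where "a = 1 / cmod (z + of_nat i)" and "b = 1 / cmod (z + of_nat (i + 1))"
      have "1 / u - 1 / v = 1 / (u * v)" if "u \<noteq> 0" "v \<noteq> 0" "v = u + 1" for u v :: complex
        using that by (simp add: divide_simps)
      from this[OF ne[of i] ne[of "i + 1"]]
      have "1 / (z + of_nat i) - 1 / (z + of_nat (i + 1)) =
            1 / ((z + of_nat i) * (z + of_nat (i + 1)))" by simp
      then have "cmod (1 / (z + of_nat i) - 1 / (z + of_nat (i + 1))) = a * b"
        by (simp add: a_def b_def norm_divide norm_mult)
      also have "\<dots> \<le> 16 * a\<^sup>2 + 16 * b\<^sup>2"
        using sum_squares_bound[of a b] zero_le_power2[of a] zero_le_power2[of b] by linarith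
      finally show ?thesis using True by (simp add: q_def a_def b_def power_divide)
    next
      case False
      then have p2: "2 \<le> p" using p by simp
      show ?thesis
        using norm_triangle_ineq4[of "1 / (z + of_nat i) ^ p" "1 / (z + of_nat (i + 1)) ^ p"]
          inverse_power_away_le[OF z p2, of i] inverse_power_away_le[OF z p2, of "i + 1"]
        by (simp add: norm_divide norm_power q_def)
    qed
    have "cmod (\<Sum>k<n. 1 / (z + of_nat (2 * k)) ^ p - 1 / (z + of_nat (2 * k + 1)) ^ p) \<le>
          (\<Sum>i<2 * n. 16 ^ p * q i)" for n
    proof -
      have "cmod (\<Sum>k<n. 1 / (z + of_nat (2 * k)) ^ p - 1 / (z + of_nat (2 * k + 1)) ^ p) \<le>
          (\<Sum>k<n. 16 ^ p * q (2 * k) + 16 ^ p * q (2 * k + 1))"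
        by (intro sum_norm_le *)
      also have "\<dots> = (\<Sum>i<2 * n. 16 ^ p * q i)"
        by (induction n) auto
      finally show ?thesis .
    qed
    then have "cmod (\<Sum>k<n. 1 / (z + of_nat (2 * k)) ^ p - 1 / (z + of_nat (2 * k + 1)) ^ p) \<le>
          16 ^ p * 1024 / (1 + \<bar>Im z\<bar>)" for n
      using q order_trans by blast
    moreover have "z \<noteq> 0" "z \<noteq> -1" using ne[of 0] ne[of 1] by auto
    ultimately show ?thesis
      using norm_sums_le[OF sums_lerch_neg[of z p]] p unfolding t by blast
  qed
qed

text \<open>The series is split at \<open>n\<close>. The terms below \<open>n\<close> are bounded
  without cancellation by \<open>32 + 2\<close> harmonic numbers. Beyond \<open>n\<close>, where
  \<open>|z + i| \<ge> i / 2\<close>, the difference has size \<open>(1 + n) / i ^ 2\<close>, so the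
  tail is at most \<open>4\<close>.\<close>

lemma norm_lerch_1_1_le:
  assumes z: "away_from_Ints z" and n: "1 \<le> n" "2 * cmod z \<le> real n"
  shows "cmod (lerch 1 1 z) \<le> 38 * harm n"
proof (rule norm_sums_le)
  have ne: "z + of_nat i \<noteq> 0" for i
    using away_from_Ints_ge[OF z, of i] by auto
  show "(\<lambda>k. 1 / (z + of_nat k) - 1 / (1 / 2 + of_nat k)) sums lerch 1 1 z"
    using ne[of 0] by (intro sums_lerch_1_1) simp
  have half: "cmod (1 / 2 + of_nat i) = 1 / 2 + real i" for i
    using norm_of_real[of "1 / 2 + real i", where ?'a = complex] by simp
  have n1: "1 \<le> (harm n :: real)"
    using harm_mono[OF n(1), where ?'a = real] by (simp add: harm_def)
  fix N
  define c where "c = min N n"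
  have split: "{..<N} = {..<c} \<union> {c..<N}" by (auto simp: c_def)
  define f where "f = (\<lambda>k. 1 / (z + of_nat k) - 1 / (1 / 2 + of_nat k))"
  have "cmod (\<Sum>i<N. f i) \<le> (\<Sum>i<N. cmod (f i))"
    by (rule norm_sum)
  also have "\<dots> = (\<Sum>i<c. cmod (f i)) + (\<Sum>i=c..<N. cmod (f i))"
    unfolding split by (intro sum.union_disjoint) auto
  also have "(\<Sum>i<c. cmod (f i)) \<le> (\<Sum>i<n. 1 / cmod (z + of_nat i) + 2 * (1 / (1 + real i)))"
  proof (rule sum_le_included[of _ _ _ id])
    show "\<forall>i\<in>{..<c}. \<exists>j\<in>{..<n}. id j = i \<and>
        cmod (f i) \<le> 1 / cmod (z + of_nat j) + 2 * (1 / (1 + real j))"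
    proof
      fix i assume "i \<in> {..<c}"
      have "cmod (f i) \<le> 1 / cmod (z + of_nat i) + 1 / (1 / 2 + real i)"
        unfolding f_def using norm_triangle_ineq4[of "1 / (z + of_nat i)" "1 / (1 / 2 + of_nat i)"]
        by (simp add: norm_divide half)
      also have "1 / (1 / 2 + real i) \<le> 2 * (1 / (1 + real i))"
        by (simp add: field_simps)
      finally show "\<exists>j\<in>{..<n}. id j = i \<and>
          cmod (f i) \<le> 1 / cmod (z + of_nat j) + 2 * (1 / (1 + real j))"
        using \<open>i \<in> {..<c}\<close> by (auto simp: c_def)
    qed
  qed auto
  also have "\<dots> = (\<Sum>i<n. 1 / cmod (z + of_nat i)) + 2 * harm n"
    unfolding sum.distrib sum_distrib_left[symmetric]
    by (simp only: harm_altdef inverse_eq_divide of_nat_Suc)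
  also have "\<dots> \<le> 34 * harm n"
    using sum_inverses_away[OF z, of n] by simp
  also have "(\<Sum>i=c..<N. cmod (f i)) \<le> (\<Sum>i=n..<N. (1 + real n) * (1 / (real i)\<^sup>2))"
  proof (cases "N \<le> n")
    case False
    then have "c = n" by (simp add: c_def)
    show ?thesis unfolding \<open>c = n\<close>
    proof (intro sum_mono)
      fix i assume i: "i \<in> {n..<N}"
      then have ri: "real n \<le> real i" "1 \<le> real i" using n by auto
      have eq: "f i = (1 / 2 - z) / ((z + of_nat i) * (1 / 2 + of_nat i))"
      proof -
        have "(1 / 2 + of_nat i :: complex) \<noteq> 0" using half[of i] by force
        then show ?thesis using ne[of i] unfolding f_def by (simp add: divide_simps) (simp add: algebra_simps)
      qed
      have "real i / 2 \<le> cmod (z + of_nat i)"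
        using norm_diff_ineq[of "of_nat i" z] n ri by (simp add: add_ac)
      then have den: "real i / 2 * real i \<le> cmod (z + of_nat i) * (1 / 2 + real i)"
        by (intro mult_mono) auto
      have num: "cmod (1 / 2 - z) \<le> (1 + real n) / 2"
        using norm_triangle_ineq4[of "1 / 2" z] n by (simp add: norm_divide)
      have "cmod (f i) \<le> ((1 + real n) / 2) / (real i / 2 * real i)"
        unfolding eq norm_divide norm_mult half
        by (intro frac_le num den) (use ri in auto)
      also have "\<dots> = (1 + real n) * (1 / (real i)\<^sup>2)"
        using ri by (simp add: power2_eq_square field_simps)
      finally show "cmod (f i) \<le> (1 + real n) * (1 / (real i)\<^sup>2)" .
    qed
  qed (auto simp: c_def)
  also have "\<dots> = (1 + real n) * (\<Sum>j<N - n. 1 / (real n + real j)\<^sup>2)"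
    unfolding sum_distrib_left
    by (rule sum.reindex_bij_witness[of _ "\<lambda>i. i + n" "\<lambda>i. i - n"]) (auto simp: add_ac)
  also have "\<dots> \<le> (1 + real n) * (2 / real n)"
    using n by (intro mult_left_mono sum_inverse_squares_le) auto
  also have "\<dots> \<le> 4" using n by (simp add: field_simps)
  finally show "cmod (\<Sum>i<N. 1 / (z + of_nat i) - 1 / (1 / 2 + of_nat i)) \<le> 38 * harm n"
    using n1 by (simp add: f_def)
qed

section \<open>Convergence of the Euler sums\<close>

text \<open>Logarithms are traded for arbitrarily small powers, which combine easily in
  products.\<close>

lemma harm_le_powr:
  assumes "0 < \<epsilon>"
  shows "harm n \<le> (1 + 1 / \<epsilon>) * (real n + 1) powr \<epsilon>"
proof -
  have "harm n \<le> 1 + ln (real n + 1)"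
  proof (cases n)
    case (Suc m)
    have "harm (Suc m) - ln (real (Suc m)) \<le> harm (Suc 0) - ln (real (Suc 0))"
      by (rule decseqD[OF decseq_harm_diff_ln]) simp
    moreover have "ln (real (Suc m)) \<le> ln (real (Suc m) + 1)"
      by (subst ln_le_cancel_iff) auto
    moreover have "harm (Suc 0) = (1 :: real)" "ln (real (Suc 0)) = 0" by (simp_all add: harm_def)
    ultimately show ?thesis unfolding Suc by linarith
  qed (simp add: harm_def)
  also have "\<dots> \<le> (real n + 1) powr \<epsilon> + (real n + 1) powr \<epsilon> / \<epsilon>"
    using ln_powr_bound[of "real n + 1" \<epsilon>] ge_one_powr_ge_zero[of "real n + 1" \<epsilon>] assms
    by (intro add_mono) auto
  also have "\<dots> = (1 + 1 / \<epsilon>) * (real n + 1) powr \<epsilon>" by (simp add: field_simps)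
  finally show ?thesis .
qed

text \<open>Quantifying over every \<epsilon> makes the property stable under products, by splitting
  \<epsilon> in halves. The bound on increments serves the conditionally convergent series, where
  absolute values are not summable.\<close>

definition slowly_varying :: "(nat \<Rightarrow> real) \<Rightarrow> bool" where
  "slowly_varying f \<longleftrightarrow> (\<forall>\<epsilon>>0. \<exists>C. \<forall>m. \<bar>f m\<bar> \<le> C * (real m + 1) powr \<epsilon> \<and>
     \<bar>f (Suc m) - f m\<bar> \<le> C * (real m + 1) powr (\<epsilon> - 1))"

lemma slowly_varyingI:
  assumes "\<And>m. \<bar>f (Suc m) - f m\<bar> \<le> 1 / (real m + 1)"
  shows "slowly_varying f"
  unfolding slowly_varying_def
proof (intro allI impI)
  fix \<epsilon> :: real assume \<epsilon>: "0 < \<epsilon>"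
  define C where "C = \<bar>f 0\<bar> + (1 + 1 / \<epsilon>)"
  have C: "1 \<le> C" using \<epsilon> by (simp add: C_def)
  show "\<exists>C. \<forall>m. \<bar>f m\<bar> \<le> C * (real m + 1) powr \<epsilon> \<and>
     \<bar>f (Suc m) - f m\<bar> \<le> C * (real m + 1) powr (\<epsilon> - 1)"
  proof (intro exI[of _ C] allI conjI)
    fix m
    have "\<bar>f m\<bar> \<le> \<bar>f 0\<bar> + harm m"
    proof (induction m)
      case (Suc m)
      then show ?case
        using assms[of m] unfolding harm_Suc by (simp add: inverse_eq_divide add_ac)
    qed (simp add: harm_def)
    also have "\<dots> \<le> \<bar>f 0\<bar> * (real m + 1) powr \<epsilon> + (1 + 1 / \<epsilon>) * (real m + 1) powr \<epsilon>"
      using harm_le_powr[OF \<epsilon>, of m] ge_one_powr_ge_zero[of "real m + 1" \<epsilon>] \<epsilon>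
      by (intro add_mono) (auto intro: mult_left_mono[of 1 _ "\<bar>f 0\<bar>", simplified])
    also have "\<dots> = C * (real m + 1) powr \<epsilon>" by (simp add: C_def algebra_simps)
    finally show "\<bar>f m\<bar> \<le> C * (real m + 1) powr \<epsilon>" .
    have "1 / (real m + 1) = 1 * (real m + 1) powr (- 1)" by (simp add: powr_minus divide_simps)
    also have "\<dots> \<le> C * (real m + 1) powr (\<epsilon> - 1)"
      using C \<epsilon> by (intro mult_mono powr_mono) auto
    finally show "\<bar>f (Suc m) - f m\<bar> \<le> C * (real m + 1) powr (\<epsilon> - 1)"
      using assms[of m] by linarith
  qed
qed

lemma slowly_varying_const: "slowly_varying (\<lambda>_. c)"
  by (rule slowly_varyingI) auto

lemma slowly_varying_mult:
  assumes "slowly_varying f" "slowly_varying g"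
  shows "slowly_varying (\<lambda>m. f m * g m)"
  unfolding slowly_varying_def
proof (intro allI impI)
  fix \<epsilon> :: real assume "0 < \<epsilon>"
  then have e2: "0 < \<epsilon> / 2" by simp
  from assms e2 obtain A B where
    A: "\<And>m. \<bar>f m\<bar> \<le> A * (real m + 1) powr (\<epsilon> / 2)"
       "\<And>m. \<bar>f (Suc m) - f m\<bar> \<le> A * (real m + 1) powr (\<epsilon> / 2 - 1)" and
    B: "\<And>m. \<bar>g m\<bar> \<le> B * (real m + 1) powr (\<epsilon> / 2)"
       "\<And>m. \<bar>g (Suc m) - g m\<bar> \<le> B * (real m + 1) powr (\<epsilon> / 2 - 1)"
    unfolding slowly_varying_def by meson
  have nn: "0 \<le> A" "0 \<le> B" using A(1)[of 0] B(1)[of 0] by auto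
  show "\<exists>C. \<forall>m. \<bar>f m * g m\<bar> \<le> C * (real m + 1) powr \<epsilon> \<and>
     \<bar>f (Suc m) * g (Suc m) - f m * g m\<bar> \<le> C * (real m + 1) powr (\<epsilon> - 1)"
  proof (intro exI[of _ "3 * A * B"] allI conjI)
    fix m
    define x where "x = real m + 1"
    have x: "1 \<le> x" by (simp add: x_def)
    have xx: "x powr (\<epsilon> / 2) * x powr (\<epsilon> / 2) = x powr \<epsilon>"
             "x powr (\<epsilon> / 2 - 1) * x powr (\<epsilon> / 2) = x powr (\<epsilon> - 1)"
             "x powr (\<epsilon> / 2) * x powr (\<epsilon> / 2 - 1) = x powr (\<epsilon> - 1)"
      by (simp_all flip: powr_add)
    have "\<bar>f m * g m\<bar> \<le> (A * x powr (\<epsilon> / 2)) * (B * x powr (\<epsilon> / 2))"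
      unfolding abs_mult using A(1)[of m] B(1)[of m] nn
      by (intro mult_mono) (auto simp: x_def)
    also have "\<dots> = A * B * (x powr (\<epsilon> / 2) * x powr (\<epsilon> / 2))" by simp
    also have "\<dots> \<le> 3 * A * B * x powr \<epsilon>" using nn unfolding xx by simp
    finally show "\<bar>f m * g m\<bar> \<le> 3 * A * B * (real m + 1) powr \<epsilon>" by (simp add: x_def)
    have "x powr (\<epsilon> / 2 - 1) \<le> x powr (\<epsilon> / 2)" using x by (intro powr_mono) auto
    then have "B * x powr (\<epsilon> / 2 - 1) \<le> B * x powr (\<epsilon> / 2)" using nn by (intro mult_left_mono)
    then have g: "\<bar>g (Suc m)\<bar> \<le> 2 * B * x powr (\<epsilon> / 2)"
      using B(1)[of m] B(2)[of m] by (simp add: x_def)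
    have "f (Suc m) * g (Suc m) - f m * g m =
          (f (Suc m) - f m) * g (Suc m) + f m * (g (Suc m) - g m)" by (simp add: algebra_simps)
    also have "\<bar>\<dots>\<bar> \<le> \<bar>f (Suc m) - f m\<bar> * \<bar>g (Suc m)\<bar> + \<bar>f m\<bar> * \<bar>g (Suc m) - g m\<bar>"
      by (metis abs_mult abs_triangle_ineq)
    also have "\<dots> \<le> (A * x powr (\<epsilon> / 2 - 1)) * (2 * B * x powr (\<epsilon> / 2)) +
                     (A * x powr (\<epsilon> / 2)) * (B * x powr (\<epsilon> / 2 - 1))"
      using A[of m] B(2)[of m] g nn by (intro add_mono mult_mono) (auto simp: x_def)
    also have "\<dots> = 2 * A * B * (x powr (\<epsilon> / 2 - 1) * x powr (\<epsilon> / 2)) +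
                     A * B * (x powr (\<epsilon> / 2) * x powr (\<epsilon> / 2 - 1))" by simp
    also have "\<dots> = 3 * A * B * x powr (\<epsilon> - 1)" unfolding xx by (simp add: algebra_simps)
    finally show "\<bar>f (Suc m) * g (Suc m) - f m * g m\<bar> \<le> 3 * A * B * (real m + 1) powr (\<epsilon> - 1)"
      by (simp add: x_def)
  qed
qed

lemma slowly_varying_prod:
  "(\<And>i. i \<in> I \<Longrightarrow> slowly_varying (f i)) \<Longrightarrow> slowly_varying (\<lambda>m. \<Prod>i\<in>I. f i m)"
  by (induction I rule: infinite_finite_induct)
     (auto intro: slowly_varying_const slowly_varying_mult)

text \<open>Summation by parts: \<open>2 * (-1) ^ m * b m\<close> is a telescoping difference minus
  the absolutely summable \<open>(-1) ^ m * (b (Suc m) - b m)\<close>.\<close>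

lemma summable_alternating_bounded_variation:
  fixes b :: "nat \<Rightarrow> real"
  assumes "b \<longlonglongrightarrow> 0" "summable (\<lambda>m. \<bar>b (Suc m) - b m\<bar>)"
  shows "summable (\<lambda>m. (-1) ^ m * b m)"
proof -
  have "(\<lambda>m. (-1) ^ m * b m) \<longlonglongrightarrow> 0"
    using assms(1) by (rule tendsto_0_le[where K = 1]) (auto simp: abs_mult power_abs)
  then have "summable (\<lambda>m. (-1) ^ m * b m - (-1) ^ Suc m * b (Suc m))"
    using sums_summable[OF telescope_sums'] by blast
  moreover have "summable (\<lambda>m. (-1) ^ m * (b (Suc m) - b m))"
    by (rule summable_rabs_cancel) (simp add: abs_mult power_abs assms(2))
  ultimately have "summable (\<lambda>m. ((-1) ^ m * b m - (-1) ^ Suc m * b (Suc m) -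
      (-1) ^ m * (b (Suc m) - b m)) / 2)"
    using summable_divide[OF summable_diff] by blast
  then show ?thesis by (simp add: algebra_simps)
qed

text \<open>With \<epsilon> = 1/2 the exponent \<open>-3/2\<close> appears in both cases: for the
  terms themselves if \<open>u \<ge> 2\<close>, and for the increments of \<open>f / D\<close> if
  \<open>u = 1\<close>. The conditions on \<open>D\<close> cover \<open>m + 1\<close> and
  \<open>m + 1/2\<close>.\<close>

lemma summable_slowly_varying:
  fixes D :: "nat \<Rightarrow> real"
  assumes f: "slowly_varying f"
    and D: "\<And>m. (real m + 1) / 2 \<le> D m" "\<And>m. D (Suc m) = D m + 1"
    and u: "1 \<le> u" "t \<in> {1, -1 :: int}" "(u, t) \<noteq> (1, 1)"
  shows "summable (\<lambda>m. of_int t ^ m * f m / D m ^ u)"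
proof -
  from f obtain C where C: "\<And>m. \<bar>f m\<bar> \<le> C * (real m + 1) powr (1 / 2)"
      "\<And>m. \<bar>f (Suc m) - f m\<bar> \<le> C * (real m + 1) powr (1 / 2 - 1)"
    unfolding slowly_varying_def by (meson half_gt_zero_iff zero_less_one)
  have C0: "0 \<le> C" using C(1)[of 0] by simp
  have conv: "summable (\<lambda>m. K * (real m + 1) powr (- 3 / 2))" for K
  proof -
    have "summable (\<lambda>m. real (Suc m) powr (- 3 / 2))"
      by (subst summable_Suc_iff) (simp add: summable_real_powr_iff)
    then show ?thesis by (intro summable_mult) (simp add: add_ac)
  qed
  have D0: "0 < D m" for m using D(1)[of m] by (smt (verit) divide_pos_pos of_nat_0_le_iff)
  have inv: "1 / D m \<le> 2 / (real m + 1)" for m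
    using D(1)[of m] D0[of m] by (simp add: field_simps)
  have tpow: "\<bar>of_int t ^ m\<bar> = (1::real)" for m using u(2) by (auto simp: power_abs)
  have p12: "x powr (1 / 2) * (1 / x\<^sup>2) = x powr (- 3 / 2)"
            "x powr (1 / 2 - 1) * (1 / x) = x powr (- 3 / 2)" if "0 < x" for x :: real
  proof -
    have "1 / x\<^sup>2 = x powr (- 2)" "1 / x = x powr (- 1)"
      using that by (simp_all add: powr_minus powr_numeral divide_simps)
    note eqs = this
    show "x powr (1 / 2) * (1 / x\<^sup>2) = x powr (- 3 / 2)"
      unfolding eqs powr_add[symmetric] by simp
    show "x powr (1 / 2 - 1) * (1 / x) = x powr (- 3 / 2)"
      unfolding eqs powr_add[symmetric] by simp
  qed
  show ?thesis
  proof (cases "u = 1")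
    case False
    then have u2: "2 \<le> u" using u by simp
    show ?thesis
    proof (rule summable_comparison_test'[OF conv[of "C * 2 ^ u"], of 0])
      fix m
      define x where "x = real m + 1"
      have x: "1 \<le> x" by (simp add: x_def)
      have "(1 / D m) ^ u \<le> (2 / x) ^ u"
        using inv[of m] D0[of m] by (intro power_mono) (auto simp: x_def)
      also have "\<dots> = 2 ^ u / x ^ u" by (simp add: power_divide)
      also have "\<dots> \<le> 2 ^ u / x\<^sup>2"
        using x u2 by (intro divide_left_mono power_increasing) auto
      finally have "(1 / D m) ^ u \<le> 2 ^ u * (1 / x\<^sup>2)" by simp
      then have "\<bar>f m\<bar> * (1 / D m) ^ u \<le> (C * x powr (1 / 2)) * (2 ^ u * (1 / x\<^sup>2))"
        using C(1)[of m] C0 D0[of m] by (intro mult_mono) (auto simp: x_def)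
      also have "\<dots> = C * 2 ^ u * (x powr (1 / 2) * (1 / x\<^sup>2))" by simp
      also have "\<dots> = C * 2 ^ u * x powr (- 3 / 2)" using x by (subst p12) auto
      finally show "norm (of_int t ^ m * f m / D m ^ u) \<le> C * 2 ^ u * (real m + 1) powr (- 3 / 2)"
        using D0[of m] by (simp add: abs_mult tpow power_divide x_def)
    qed
  next
    case True
    then have t: "t = -1" using u by auto
    define b where "b = (\<lambda>m. f m / D m)"
    have "b \<longlonglongrightarrow> 0"
    proof (rule Lim_null_comparison)
      show "\<forall>\<^sub>F m in sequentially. norm (b m) \<le> C * (real m + 1) powr (1 / 2) * (2 / (real m + 1))"
      proof (intro always_eventually allI)
        fix m
        have "\<bar>f m\<bar> * (1 / D m) \<le> C * (real m + 1) powr (1 / 2) * (2 / (real m + 1))"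
          using C(1)[of m] C0 D0[of m] inv[of m] by (intro mult_mono) auto
        then show "norm (b m) \<le> C * (real m + 1) powr (1 / 2) * (2 / (real m + 1))"
          using D0[of m] by (simp add: b_def)
      qed
      show "(\<lambda>m. C * (real m + 1) powr (1 / 2) * (2 / (real m + 1))) \<longlonglongrightarrow> 0"
        by real_asymp
    qed
    moreover have "summable (\<lambda>m. \<bar>b (Suc m) - b m\<bar>)"
    proof (rule summable_comparison_test'[OF conv[of "6 * C"], of 0])
      fix m
      define x where "x = real m + 1"
      have x: "1 \<le> x" by (simp add: x_def)
      have i1: "1 / D (Suc m) \<le> 2 / x"
        using inv[of m] D0[of m] D(2)[of m] by (simp add: x_def field_simps)
      have i2: "1 / D m \<le> 2 / x" using inv[of m] by (simp add: x_def)
      have "b (Suc m) - b m = (f (Suc m) - f m) * (1 / D (Suc m)) - f m * (1 / D m * (1 / D (Suc m)))"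
      proof -
        have "1 / D m * (1 / D (Suc m)) = 1 / D m - 1 / D (Suc m)"
          using D0[of m] unfolding D(2) by (simp add: divide_simps)
        then show ?thesis unfolding b_def by (simp only:) (simp add: algebra_simps)
      qed
      also have "\<bar>\<dots>\<bar> \<le> \<bar>f (Suc m) - f m\<bar> * (1 / D (Suc m)) + \<bar>f m\<bar> * (1 / D m * (1 / D (Suc m)))"
        using D0[of m] D0[of "Suc m"]
        by (intro order_trans[OF abs_triangle_ineq4]) (simp add: abs_mult)
      also have "\<dots> \<le> (C * x powr (1 / 2 - 1)) * (2 / x) + (C * x powr (1 / 2)) * (2 / x * (2 / x))"
        using C[of m] C0 D0[of m] D0[of "Suc m"] i1 i2 x
        by (intro add_mono mult_mono) (auto simp: x_def)
      also have "\<dots> = 2 * C * (x powr (1 / 2 - 1) * (1 / x)) + 4 * C * (x powr (1 / 2) * (1 / x\<^sup>2))"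
        by (simp add: power2_eq_square mult_ac)
      also have "\<dots> = 6 * C * x powr (- 3 / 2)"
        unfolding p12[OF less_le_trans[OF zero_less_one x]] by simp
      finally show "norm \<bar>b (Suc m) - b m\<bar> \<le> 6 * C * (real m + 1) powr (- 3 / 2)"
        by (simp add: x_def)
    qed
    ultimately have "summable (\<lambda>m. (-1) ^ m * b m)"
      by (rule summable_alternating_bounded_variation)
    then show ?thesis using True by (simp add: b_def t)
  qed
qed

lemma slowly_varying_h_sum:
  assumes "1 \<le> r" "t \<in> {1, -1}"
  shows "slowly_varying (\<lambda>m. h_sum r t (m + 1))"
proof (rule slowly_varyingI)
  fix m
  \<comment> \<open>The increment is the term with index \<open>j = m + 2\<close>, whose denominator
    is \<open>(m + 3/2) ^ r\<close>.\<close>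
  have "real m + 1 \<le> (real m + 3 / 2) ^ 1" by simp
  also have "\<dots> \<le> (real m + 3 / 2) ^ r" using assms by (intro power_increasing) auto
  finally have "1 / (real m + 3 / 2) ^ r \<le> 1 / (real m + 1)" by (intro divide_left_mono) auto
  then show "\<bar>h_sum r t (Suc m + 1) - h_sum r t (m + 1)\<bar> \<le> 1 / (real m + 1)"
    using assms(2) by (auto simp: h_sum_def power_abs abs_mult add_ac)
qed

lemma slowly_varying_H_sum:
  assumes "1 \<le> r" "t \<in> {1, -1}"
  shows "slowly_varying (\<lambda>m. H_sum r t m)"
proof (rule slowly_varyingI)
  fix m
  have "(real m + 1) ^ 1 \<le> (real m + 1) ^ r" using assms by (intro power_increasing) auto
  then have "1 / (real m + 1) ^ r \<le> 1 / (real m + 1)" by (intro divide_left_mono) auto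
  then show "\<bar>H_sum r t (Suc m) - H_sum r t m\<bar> \<le> 1 / (real m + 1)"
    using assms(2) by (auto simp: H_sum_def power_abs abs_mult add_ac)
qed

lemma summable_euler_S:
  assumes "euler_index k p s q \<sigma>"
  shows "summable (\<lambda>m. of_int \<sigma> ^ m * (\<Prod>i=1..k. h_sum (p i) (s i) (m + 1)) / real (m + 1) ^ q)"
  using assms unfolding euler_index_def
  by (intro summable_slowly_varying slowly_varying_prod slowly_varying_h_sum) auto

lemma summable_euler_R:
  assumes "euler_index k p s q \<sigma>"
  shows "summable (\<lambda>m. of_int \<sigma> ^ m * (\<Prod>i=1..k. H_sum (p i) (s i) m) / (real (m + 1) - 1/2) ^ q)"
  using assms unfolding euler_index_def
  by (intro summable_slowly_varying slowly_varying_prod slowly_varying_H_sum) auto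

section \<open>The algebra generated by the sums of lower degree, and spans over it\<close>

definition lower_algebra :: "nat \<Rightarrow> complex set" where
  "lower_algebra k = complex_of_real ` {x. rat_polynomial_in (euler_sums_below k) x}"

interpretation lower: rational_subalgebra "lower_algebra k" for k
  unfolding lower_algebra_def by (rule rational_subalgebra_polynomials)

definition h_seq :: "nat \<Rightarrow> int \<Rightarrow> nat \<Rightarrow> complex" where
  "h_seq r t m = of_real (h_sum r t (m + 1))"

definition H_seq :: "nat \<Rightarrow> int \<Rightarrow> nat \<Rightarrow> complex" where
  "H_seq r t m = of_real (H_sum r t m)"

definition nat_pole :: "nat \<Rightarrow> complex" where
  "nat_pole m = of_nat (m + 1)"

definition half_pole :: "nat \<Rightarrow> complex" where
  "half_pole m = of_nat m + 1 / 2"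

interpretation span_S: euler_span "lower_algebra k" h_seq nat_pole for k ..

interpretation span_R: euler_span "lower_algebra k" H_seq half_pole for k ..

lemma lower_algebra_S: "l < k \<Longrightarrow> euler_index l p s q \<sigma> \<Longrightarrow> of_real (euler_S l p s q \<sigma>) \<in> lower_algebra k"
  unfolding lower_algebra_def
  by (intro imageI CollectI rat_polynomial_in_mem) (unfold euler_sums_below_def, blast)

lemma lower_algebra_R: "l < k \<Longrightarrow> euler_index l p s q \<sigma> \<Longrightarrow> of_real (euler_R l p s q \<sigma>) \<in> lower_algebra k"
  unfolding lower_algebra_def
  by (intro imageI CollectI rat_polynomial_in_mem) (unfold euler_sums_below_def, blast)

lemma prod_list_conv_prod:
  fixes f :: "'a \<Rightarrow> 'b :: comm_monoid_mult"
  shows "prod_list (map f xs) = (\<Prod>i=1..length xs. f (xs ! (i - 1)))"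
proof -
  have "prod_list (map f xs) = (\<Prod>i<length xs. f (xs ! i))"
    by (simp add: prod.list_conv_set_nth atLeast0LessThan)
  also have "\<dots> = (\<Prod>i=1..length xs. f (xs ! (i - 1)))"
    by (rule prod.reindex_bij_witness[of _ "\<lambda>i. i - 1" Suc]) auto
  finally show ?thesis .
qed

text \<open>The excluded pair cannot reappear when the exponent grows: \<open>v = 1\<close> forces
  \<open>q = 1\<close>.\<close>

lemma euler_index_of_list:
  assumes "valid_indices xs" "1 \<le> q" "q \<le> v" "\<sigma> \<in> {1, -1}" "(q, \<sigma>) \<noteq> (1, 1)"
  shows "euler_index (length xs) (\<lambda>i. fst (xs ! (i - 1))) (\<lambda>i. snd (xs ! (i - 1))) v \<sigma>"
proof -
  have "1 \<le> fst (xs ! (i - 1)) \<and> snd (xs ! (i - 1)) \<in> {1, -1}" if "i \<in> {1..length xs}" for i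
  proof -
    have "xs ! (i - 1) \<in> set xs" using that by (intro nth_mem) auto
    then show ?thesis using assms(1) unfolding valid_indices_def by auto
  qed
  then show ?thesis using assms unfolding euler_index_def by auto
qed

text \<open>Since \<open>d \<le> k\<close> and the bound in \<open>E\<close> is strict, each
  monomial is the general term of a sum of degree less than \<open>k\<close>.\<close>

lemma span_S_sums:
  assumes "span_S.E k d q f" "d \<le> k" "1 \<le> q" "\<sigma> \<in> {1, -1}" "(q, \<sigma>) \<noteq> (1, 1)"
  shows "\<exists>x\<in>lower_algebra k. (\<lambda>m. of_int \<sigma> ^ m * f m) sums x"
proof (rule span_S.E_sums[OF assms(1)])
  fix xs v assume xs: "length xs < d" "valid_indices xs" "q \<le> v"
  note ind = euler_index_of_list[OF xs(2) assms(3) xs(3) assms(4,5)]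
  show "\<exists>x\<in>lower_algebra k. (\<lambda>m. of_int \<sigma> ^ m * span_S.mon xs v m) sums x"
  proof (rule bexI)
    show "complex_of_real (euler_S (length xs) (\<lambda>i. fst (xs ! (i - 1))) (\<lambda>i. snd (xs ! (i - 1))) v \<sigma>)
          \<in> lower_algebra k"
      using xs assms(2) by (intro lower_algebra_S ind) auto
    show "(\<lambda>m. of_int \<sigma> ^ m * span_S.mon xs v m) sums
          complex_of_real (euler_S (length xs) (\<lambda>i. fst (xs ! (i - 1))) (\<lambda>i. snd (xs ! (i - 1))) v \<sigma>)"
      using sums_of_real[OF summable_sums[OF summable_euler_S[OF ind]], where ?'a = complex]
      unfolding span_S.mon_def prod_list_conv_prod case_prod_unfold
      by (simp add: euler_S_def h_seq_def nat_pole_def)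
  qed
qed

lemma span_R_sums:
  assumes "span_R.E k d q f" "d \<le> k" "1 \<le> q" "\<sigma> \<in> {1, -1}" "(q, \<sigma>) \<noteq> (1, 1)"
  shows "\<exists>x\<in>lower_algebra k. (\<lambda>m. of_int \<sigma> ^ m * f m) sums x"
proof (rule span_R.E_sums[OF assms(1)])
  fix xs v assume xs: "length xs < d" "valid_indices xs" "q \<le> v"
  note ind = euler_index_of_list[OF xs(2) assms(3) xs(3) assms(4,5)]
  show "\<exists>x\<in>lower_algebra k. (\<lambda>m. of_int \<sigma> ^ m * span_R.mon xs v m) sums x"
  proof (rule bexI)
    show "complex_of_real (euler_R (length xs) (\<lambda>i. fst (xs ! (i - 1))) (\<lambda>i. snd (xs ! (i - 1))) v \<sigma>)
          \<in> lower_algebra k"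
      using xs assms(2) by (intro lower_algebra_R ind) auto
    show "(\<lambda>m. of_int \<sigma> ^ m * span_R.mon xs v m) sums
          complex_of_real (euler_R (length xs) (\<lambda>i. fst (xs ! (i - 1))) (\<lambda>i. snd (xs ! (i - 1))) v \<sigma>)"
      using sums_of_real[OF summable_sums[OF summable_euler_R[OF ind]], where ?'a = complex]
      unfolding span_R.mon_def prod_list_conv_prod case_prod_unfold
      by (simp add: euler_R_def H_seq_def half_pole_def add_ac)
  qed
qed

text \<open>As \<open>k \<ge> 1\<close>, sums of degree \<open>0\<close> count as lower sums. The
  one divergent index pair contributes \<open>0\<close> by normalisation.\<close>

lemma lerch_half_mem:
  assumes "1 \<le> k" "1 \<le> p" "t \<in> {1, -1}"
  shows "lerch p t (1 / 2) \<in> lower_algebra k"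
proof (cases "(p, t) = (1, 1)")
  case True
  then have "p = 1" "t = 1" by auto
  then show ?thesis by (simp only: lerch_1_1_half lower.zero_mem)
next
  case False
  have "lerch p t (1 / 2) = of_real (euler_R 0 (\<lambda>_. 1) (\<lambda>_. 1) p t)"
    using lerch_of_real[of "1 / 2" p t] assms False by (simp add: euler_R_def add_ac)
  also have "\<dots> \<in> lower_algebra k"
    using assms False by (intro lower_algebra_R) (auto simp: euler_index_def)
  finally show ?thesis .
qed

lemma lerch_one_mem:
  assumes "1 \<le> k" "1 \<le> p" "t \<in> {1, -1}"
  shows "lerch p t 1 \<in> lower_algebra k"
proof -
  have *: "of_real (euler_S 0 (\<lambda>_. 1) (\<lambda>_. 1) p t) \<in> lower_algebra k"
    if "1 \<le> p" "t \<in> {1, -1}" "(p, t) \<noteq> (1, 1)" for p t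
    using assms that by (intro lower_algebra_S) (auto simp: euler_index_def)
  show ?thesis
  proof (cases "(p, t) = (1, 1)")
    case True
    have "euler_S 0 (\<lambda>_. 1) (\<lambda>_. 1) 1 (-1) = ln 2"
      using sums_unique[OF alternating_harmonic_series_sums] by (simp add: euler_S_def add_ac)
    then have "complex_of_real (ln 2) \<in> lower_algebra k" using *[of 1 "-1"] by simp
    then have "of_int (-2) * complex_of_real (ln 2) \<in> lower_algebra k"
      by (intro lower.mult_mem lower.of_int_mem)
    moreover have "p = 1" "t = 1" using True by auto
    ultimately show ?thesis by (simp only: lerch_1_1_1) simp
  next
    case False
    have "lerch p t 1 = of_real (euler_S 0 (\<lambda>_. 1) (\<lambda>_. 1) p t)"
      using lerch_of_real[of 1 p t] assms False by (simp add: euler_S_def h_seq_def nat_pole_def)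
    then show ?thesis using * assms False by simp
  qed
qed

section \<open>Local expansions of the kernel\<close>

lemma sign_mult_self:
  assumes "t \<in> {1, -1 :: int}"
  shows "(of_int t * of_int t :: complex) = 1" "(of_int t * (of_int t * x) :: complex) = x"
  using assms by auto

lemma lerch_diff_nat:
  assumes "1 \<le> p" "t \<in> {1, -1}" "\<And>i. i \<in> {1..m} \<Longrightarrow> z \<noteq> of_nat i"
  shows "of_int t ^ m * lerch p t (z - of_nat m) =
         lerch p t z + (\<Sum>i=1..m. of_int t ^ i / (z - of_nat i) ^ p)"
  using assms(3)
proof (induction m)
  case (Suc m)
  have "z - of_nat (Suc m) \<noteq> 0" using Suc.prems[of "Suc m"] by auto
  from lerch_plus1[OF this assms(1,2)]
  have "lerch p t (z - of_nat (Suc m)) =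
      1 / (z - of_nat (Suc m)) ^ p + of_int t * lerch p t (z - of_nat m)"
    by (simp add: algebra_simps)
  then have "of_int t ^ Suc m * lerch p t (z - of_nat (Suc m)) =
      of_int t ^ Suc m / (z - of_nat (Suc m)) ^ p +
      of_int t * of_int t * (of_int t ^ m * lerch p t (z - of_nat m))"
    by (simp only:) (simp add: algebra_simps)
  also have "of_int t * of_int t = (1 :: complex)" by (rule sign_mult_self[OF assms(2)])
  also have "of_int t ^ m * lerch p t (z - of_nat m) =
      lerch p t z + (\<Sum>i=1..m. of_int t ^ i / (z - of_nat i) ^ p)"
    using Suc.prems by (intro Suc.IH) auto
  finally show ?case by simp
qed simp

lemma lerch_plus_nat:
  assumes "1 \<le> p" "t \<in> {1, -1}" "\<And>i. i < m \<Longrightarrow> z + of_nat i \<noteq> 0"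
  shows "of_int t ^ m * lerch p t (z + of_nat m) =
         lerch p t z - (\<Sum>i<m. of_int t ^ i / (z + of_nat i) ^ p)"
  using assms(3)
proof (induction m)
  case (Suc m)
  have "z + of_nat m \<noteq> 0" using Suc.prems[of m] by auto
  from lerch_plus1[OF this assms(1,2)]
  have "of_int t ^ m * lerch p t (z + of_nat m) =
      of_int t ^ m / (z + of_nat m) ^ p + of_int t ^ Suc m * lerch p t (z + of_nat (Suc m))"
    by (simp add: algebra_simps)
  moreover have "of_int t ^ m * lerch p t (z + of_nat m) =
      lerch p t z - (\<Sum>i<m. of_int t ^ i / (z + of_nat i) ^ p)"
    using Suc.prems by (intro Suc.IH) auto
  ultimately show ?case by (simp add: algebra_simps)
qed simp

text \<open>This is the value of the \<open>i\<close>-th factor of the integrand at the integer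
  \<open>n\<close>. The factor \<open>(-1) ^ p\<close> comes from turning \<open>1/2 - i\<close>
  into \<open>i - 1/2\<close>, the factor \<open>t\<close> from the exponent \<open>i - 1\<close> in
  \<open>h_sum\<close>. Neither occurs at \<open>-n\<close>, and this asymmetry is the source of the
  parity condition.\<close>

lemma lerch_half_minus_nat:
  assumes "1 \<le> p" "t \<in> {1, -1}"
  shows "lerch p t (1 / 2 - of_nat n) =
         of_int t ^ n * (lerch p t (1 / 2) + (-1) ^ p * of_int t * of_real (h_sum p t n))"
proof -
  have ne: "(1 / 2 :: complex) \<noteq> of_nat i" for i
  proof
    assume "(1 / 2 :: complex) = of_nat i"
    then have "of_nat (2 * i) = (of_nat 1 :: complex)" by (simp add: mult.commute)
    then have "2 * i = 1" unfolding of_nat_eq_iff .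
    then show False by presburger
  qed
  have "(\<Sum>i=1..n. of_int t ^ i / (1 / 2 - of_nat i :: complex) ^ p) =
        (-1) ^ p * of_int t * of_real (h_sum p t n)"
    unfolding h_sum_def of_real_sum sum_distrib_left
  proof (intro sum.cong refl)
    fix i assume "i \<in> {1..n}"
    then have "of_int t ^ i = (of_int t * of_int t ^ (i - 1) :: complex)"
      by (cases i) auto
    moreover have "(1 / 2 - of_nat i :: complex) ^ p = (-1) ^ p * (of_nat i - 1 / 2) ^ p"
      by (simp flip: power_mult_distrib)
    moreover have "a / ((-1) ^ p * b) = (-1) ^ p * (a / b)" for a b :: complex
      by (cases "even p") auto
    ultimately show "of_int t ^ i / (1 / 2 - of_nat i :: complex) ^ p =
        (-1) ^ p * of_int t * of_real (of_int t ^ (i - 1) / (real i - 1 / 2) ^ p)"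
      by (simp only: of_real_divide of_real_power of_real_diff of_real_of_int_eq of_real_of_nat_eq
          of_real_1 of_real_numeral times_divide_eq_right mult.assoc)
  qed
  moreover have "of_int t ^ n * (of_int t ^ n * x) = (x :: complex)" for x
    using sign_mult_self[OF assms(2)] by (simp flip: mult.assoc power_mult_distrib)
  ultimately show ?thesis
    using lerch_diff_nat[OF assms, of n "1 / 2"] ne by metis
qed

lemma lerch_half_plus_nat:
  assumes "1 \<le> p" "t \<in> {1, -1}"
  shows "lerch p t (1 / 2 + of_nat n) =
         of_int t ^ n * (lerch p t (1 / 2) - of_real (h_sum p t n))"
proof -
  have ne: "(1 / 2 :: complex) + of_nat i \<noteq> 0" for i
    by (simp add: complex_eq_iff)
  have "(\<Sum>i<n. of_int t ^ i / (1 / 2 + of_nat i :: complex) ^ p) = of_real (h_sum p t n)"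
    unfolding h_sum_def of_real_sum
    by (rule sum.reindex_bij_witness[of _ "\<lambda>i. i - 1" Suc]) (auto simp: of_nat_diff)
  moreover have "of_int t ^ n * (of_int t ^ n * x) = (x :: complex)" for x
    using sign_mult_self[OF assms(2)] by (simp flip: mult.assoc power_mult_distrib)
  ultimately show ?thesis
    using lerch_plus_nat[OF assms, of n "1 / 2"] ne by metis
qed

text \<open>
  For \<open>t = 1\<close> this is \<open>\<pi> cot (\<pi> z)\<close> and for \<open>t = -1\<close> it is \<open>\<pi> / sin (\<pi> z)\<close>.
\<close>

definition trig_kernel :: "int \<Rightarrow> complex \<Rightarrow> complex" where
  "trig_kernel t z = lerch 1 t z - of_int t * lerch 1 t (1 - z)"

text \<open>The terms \<open>1 / z\<close> and \<open>1 / (- z)\<close> split off by the two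
  recurrences cancel, leaving pure quasi-periodicity.\<close>

lemma kernel_plus1:
  assumes "z \<noteq> 0" "t \<in> {1, -1}"
  shows "trig_kernel t (z + 1) = of_int t * trig_kernel t z"
proof -
  have "lerch 1 t z = 1 / z + of_int t * lerch 1 t (z + 1)"
       "lerch 1 t (- z) = 1 / (- z) + of_int t * lerch 1 t (1 - z)"
    using lerch_plus1[of z 1 t] lerch_plus1[of "- z" 1 t] assms by (simp_all add: add_ac)
  then show ?thesis using assms(2) by (auto simp: trig_kernel_def)
qed

lemma kernel_plus_nat:
  assumes "\<And>i. i < n \<Longrightarrow> z + of_nat i \<noteq> 0" "t \<in> {1, -1}"
  shows "trig_kernel t (z + of_nat n) = of_int t ^ n * trig_kernel t z"
  using assms(1)
proof (induction n)
  case (Suc n)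
  then show ?case
    using kernel_plus1[of "z + of_nat n" t] assms(2) by (simp add: add_ac)
qed simp

lemma kernel_plus_int:
  assumes "z \<notin> \<int>" "t \<in> {1, -1}"
  shows "trig_kernel t (z + of_int n) = of_int t ^ nat \<bar>n\<bar> * trig_kernel t z"
proof (cases "0 \<le> n")
  case True
  have "z + of_nat i \<noteq> 0" for i
    using assms(1) Ints_minus[OF Ints_of_nat[of i]] by (auto simp: eq_neg_iff_add_eq_0[symmetric])
  then show ?thesis using kernel_plus_nat[of "nat n" z t] assms(2) True by simp
next
  case False
  define m where "m = nat (- n)"
  have n: "n = - int m" using False by (simp add: m_def)
  have "z - of_nat m + of_nat i \<noteq> 0" for i
  proof
    assume "z - of_nat m + of_nat i = 0"
    then have "z = of_nat m - of_nat i" by (simp add: algebra_simps)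
    with assms(1) show False by simp
  qed
  from kernel_plus_nat[OF this assms(2), of m]
  have "trig_kernel t z = of_int t ^ m * trig_kernel t (z - of_nat m)" by simp
  moreover have "of_int t ^ m * (of_int t ^ m * x) = (x :: complex)" for x
    using sign_mult_self[OF assms(2)] by (simp flip: mult.assoc power_mult_distrib)
  ultimately show ?thesis by (simp add: n)
qed

lemma holomorphic_on_kernel: "A \<inter> \<int> = {} \<Longrightarrow> trig_kernel t holomorphic_on A"
proof -
  assume A: "A \<inter> \<int> = {}"
  have "z \<notin> \<int>\<^sub>\<le>\<^sub>0" "1 - z \<notin> \<int>\<^sub>\<le>\<^sub>0" if "z \<in> A" for z
  proof -
    have "z \<notin> \<int>" using A that by blast
    moreover from this have "1 - z \<notin> \<int>" using Ints_diff[OF Ints_1, of "1 - z"] by auto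
    ultimately show "z \<notin> \<int>\<^sub>\<le>\<^sub>0" "1 - z \<notin> \<int>\<^sub>\<le>\<^sub>0"
      using nonpos_Ints_subset_Ints by blast+
  qed
  then show ?thesis
    unfolding trig_kernel_def[abs_def] by (intro holomorphic_intros) auto
qed

lemma kernel_near_0:
  assumes "z \<noteq> 0" "t \<in> {1, -1}"
  shows "trig_kernel t z = 1 / z + of_int t * (lerch 1 t (1 + z) - lerch 1 t (1 - z))"
  using lerch_plus1[of z 1 t] assms by (simp add: trig_kernel_def add_ac algebra_simps)

text \<open>The pole at \<open>0\<close> is simple with residue \<open>1\<close>, and
  quasi-periodicity carries it to every integer. The exponent \<open>|n|\<close> is correct for
  negative \<open>n\<close> because \<open>t\<close> is its own inverse.\<close>

lemma tendsto_kernel_int: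
  assumes "t \<in> {1, -1}"
  shows "(\<lambda>z. trig_kernel t z * (z - of_int n)) \<midarrow>of_int n\<rightarrow> of_int t ^ nat \<bar>n\<bar>"
proof -
  have "isCont (\<lambda>z. lerch 1 t (1 + z)) 0"
    by (rule isCont_o2[OF _ DERIV_isCont[OF has_field_derivative_lerch]]) (auto intro!: continuous_intros)
  moreover have "isCont (\<lambda>z. lerch 1 t (1 - z)) 0"
    by (rule isCont_o2[OF _ DERIV_isCont[OF has_field_derivative_lerch]]) (auto intro!: continuous_intros)
  ultimately have "isCont (\<lambda>z. of_int t ^ nat \<bar>n\<bar> *
      (1 + z * of_int t * (lerch 1 t (1 + z) - lerch 1 t (1 - z)))) 0"
    by (intro continuous_intros)
  then have lim: "(\<lambda>z. of_int t ^ nat \<bar>n\<bar> *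
      (1 + z * of_int t * (lerch 1 t (1 + z) - lerch 1 t (1 - z)))) \<midarrow>0\<rightarrow> of_int t ^ nat \<bar>n\<bar>"
    unfolding isCont_def by simp
  have "eventually (\<lambda>z. z \<in> ball 0 1 - {0 :: complex}) (at 0)"
    by (intro eventually_at_in_open) auto
  then have "eventually (\<lambda>z. of_int t ^ nat \<bar>n\<bar> *
      (1 + z * of_int t * (lerch 1 t (1 + z) - lerch 1 t (1 - z))) =
      trig_kernel t (z + of_int n) * (z + of_int n - of_int n)) (at 0)"
  proof eventually_elim
    case (elim z)
    have "z \<notin> \<int>"
    proof
      assume "z \<in> \<int>"
      then obtain j where "z = of_int j" by (elim Ints_cases)
      with elim show False by auto
    qed
    then show ?case
    proof -
      have "trig_kernel t (z + of_int n) = of_int t ^ nat \<bar>n\<bar> *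
          (1 / z + of_int t * (lerch 1 t (1 + z) - lerch 1 t (1 - z)))"
        using kernel_plus_int[OF \<open>z \<notin> \<int>\<close> assms, of n] kernel_near_0[of z t] elim assms by simp
      also have "\<dots> * (z + of_int n - of_int n) = of_int t ^ nat \<bar>n\<bar> *
          (z * (1 / z) + z * of_int t * (lerch 1 t (1 + z) - lerch 1 t (1 - z)))"
        by (simp add: algebra_simps)
      finally show ?thesis using elim by simp
    qed
  qed
  from Lim_transform_eventually[OF lim this]
  have "(\<lambda>z. trig_kernel t (z + of_int n) * (z + of_int n - of_int n)) \<midarrow>0\<rightarrow> of_int t ^ nat \<bar>n\<bar>" .
  then show ?thesis
    using LIM_offset_zero_iff[of "of_int n" "\<lambda>z. trig_kernel t z * (z - of_int n)"] by (simp add: add_ac)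
qed

lemma has_fps_expansion_lerch_minus:
  assumes "z \<notin> \<int>\<^sub>\<le>\<^sub>0" "1 \<le> p"
  shows "(\<lambda>x. lerch p t (z - x)) has_fps_expansion
           Abs_fps (\<lambda>r. pochhammer (of_nat p) r / fact r * lerch (p + r) t z)"
proof -
  have "((\<lambda>x. lerch p t (z + x)) \<circ> (\<lambda>x. - x)) has_fps_expansion
      (Abs_fps (\<lambda>r. (-1) ^ r * pochhammer (of_nat p) r / fact r * lerch (p + r) t z) oo (- fps_X))"
    by (intro has_fps_expansion_compose has_fps_expansion_lerch assms fps_expansion_intros) auto
  then show ?thesis
    by (simp add: o_def fps_compose_uminus' flip: mult.assoc power_mult_distrib)
qed

section \<open>Laurent coefficients inside the lower algebra\<close>

context rational_subalgebra
begin

lemma taylor_coeff_mem: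
  "pochhammer (of_nat p) r / fact r \<in> W"
  "(-1) ^ r * pochhammer (of_nat p) r / fact r \<in> W"
proof -
  have "of_rat (of_nat (pochhammer p r) / of_nat (fact r)) \<in> W"
       "of_rat ((-1) ^ r * of_nat (pochhammer p r) / of_nat (fact r)) \<in> W" by (rule rat_mem)+
  moreover have "of_rat (fact r) = (fact r :: complex)" by (metis of_nat_fact of_rat_of_nat_eq)
  ultimately show "pochhammer (of_nat p) r / fact r \<in> W"
      "(-1) ^ r * pochhammer (of_nat p) r / fact r \<in> W"
    by (simp_all add: of_rat_divide of_rat_mult of_rat_power pochhammer_of_nat of_rat_minus)
qed

end

definition lerch_fps :: "nat \<Rightarrow> int \<Rightarrow> complex \<Rightarrow> complex fps" where
  "lerch_fps p t z = Abs_fps (\<lambda>r. (-1) ^ r * pochhammer (of_nat p) r / fact r * lerch (p + r) t z)"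

definition lerch_minus_fps :: "nat \<Rightarrow> int \<Rightarrow> complex \<Rightarrow> complex fps" where
  "lerch_minus_fps p t z = Abs_fps (\<lambda>r. pochhammer (of_nat p) r / fact r * lerch (p + r) t z)"

definition inverse_power_fps :: "nat \<Rightarrow> complex \<Rightarrow> complex fps" where
  "inverse_power_fps p z =
     Abs_fps (\<lambda>r. (-1) ^ r * pochhammer (of_nat p) r / fact r * (1 / z ^ (p + r)))"

text \<open>After shifting by integers, \<open>1\<close> and \<open>1/2\<close> are the only base
  points that occur, and there all values of \<open>lerch\<close> are degree \<open>0\<close> sums,
  \<open>0\<close> or \<open>-2 ln 2\<close>.\<close>

lemma lerch_fps_mem:
  assumes "1 \<le> k" "1 \<le> p" "t \<in> {1, -1}" "z \<in> {1, 1 / 2}"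
  shows "lerch_fps p t z $ r \<in> lower_algebra k" "lerch_minus_fps p t z $ r \<in> lower_algebra k"
proof -
  have "lerch (p + r) t z \<in> lower_algebra k"
    using assms(4)
  proof (elim insertE emptyE)
    assume "z = 1"
    then show ?thesis using lerch_one_mem[of k "p + r" t] assms(1-3) by simp
  next
    assume "z = 1 / 2"
    then show ?thesis using lerch_half_mem[of k "p + r" t] assms(1-3) by (simp only:)
  qed
  then show "lerch_fps p t z $ r \<in> lower_algebra k" "lerch_minus_fps p t z $ r \<in> lower_algebra k"
    by (simp_all only: lerch_fps_def lerch_minus_fps_def fps_nth_Abs_fps
        lower.mult_mem lower.taylor_coeff_mem)
qed

lemma fps_to_fls_mem:
  "(\<And>r. F $ r \<in> lower_algebra k) \<Longrightarrow> fps_to_fls F $$ i \<in> lower_algebra k"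
  by (auto simp: lower.zero_mem)

lemma fls_X_intpow_mem: "(fls_X_intpow n :: complex fls) $$ i \<in> lower_algebra k"
  by (auto simp: lower.zero_mem lower.one_mem)

lemma kernel_expansion_0:
  assumes "1 \<le> k" "t \<in> {1, -1}"
  obtains A where "trig_kernel t has_laurent_expansion A" "\<And>i. A $$ i \<in> lower_algebra k"
proof
  define B where "B = fps_const (of_int t) * (lerch_fps 1 t 1 - lerch_minus_fps 1 t 1)"
  define A where "A = fls_X_intpow (- 1) + fps_to_fls B"
  have "(\<lambda>z. z powi (- 1) + of_int t * (lerch 1 t (1 + z) - lerch 1 t (1 - z)))
      has_laurent_expansion A"
    unfolding A_def B_def lerch_fps_def lerch_minus_fps_def
    by (intro has_laurent_expansion_add has_laurent_expansion_fps_X_power_int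
        has_laurent_expansion_fps has_fps_expansion_cmult_left has_fps_expansion_diff
        has_fps_expansion_lerch has_fps_expansion_lerch_minus) auto
  also have "?this \<longleftrightarrow> trig_kernel t has_laurent_expansion A"
    using assms
    by (intro has_laurent_expansion_cong refl) (auto simp: eventually_at_filter kernel_near_0
          power_int_minus inverse_eq_divide)
  finally show "trig_kernel t has_laurent_expansion A" .
  have "B $ r \<in> lower_algebra k" for r
    unfolding B_def using assms
    by (auto simp del: One_nat_def intro!: lower.mult_mem lower.diff_mem lerch_fps_mem lower.of_int_mem)
  then show "A $$ i \<in> lower_algebra k" for i
    unfolding A_def by (auto simp: lower.one_mem lower.zero_mem intro!: lower.add_mem)
qed

lemma half_plus_notin_nonpos_Ints: "1 / 2 + of_nat n \<notin> (\<int>\<^sub>\<le>\<^sub>0 :: complex set)"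
  by (auto elim!: nonpos_Ints_cases' simp: complex_eq_iff)

lemma half_notin_nonpos_Ints: "1 / 2 \<notin> (\<int>\<^sub>\<le>\<^sub>0 :: complex set)"
  using half_plus_notin_nonpos_Ints[of 0] by simp

lemma half_notin_Ints: "of_nat m + 1 / 2 \<notin> (\<int> :: complex set)"
proof
  assume "of_nat m + 1 / 2 \<in> (\<int> :: complex set)"
  then obtain j where "of_nat m + 1 / 2 = (of_int j :: complex)" by (elim Ints_cases)
  then have "of_int (2 * int m + 1) = (of_int (2 * j) :: complex)" by (simp add: field_simps)
  then have "2 * int m + 1 = 2 * j" unfolding of_int_eq_iff .
  then show False by presburger
qed

text \<open>By quasi-periodicity the expansion at \<open>m + 1/2\<close> is the one at
  \<open>1/2\<close> up to sign. So a single power series with constant coefficients serves all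
  \<open>m\<close>: degree \<open>0\<close> and no polar part.\<close>

lemma kernel_expansion_half:
  assumes "1 \<le> k" "t \<in> {1, -1}"
  obtains A where
    "\<And>m. (\<lambda>x. trig_kernel t (half_pole m + x)) has_laurent_expansion fls_const (of_int t ^ m) * A"
    "span_R.L k 0 0 (\<lambda>_. A)"
proof
  define B where "B = lerch_fps 1 t (1 / 2) - fps_const (of_int t) * lerch_minus_fps 1 t (1 / 2)"
  have B: "(\<lambda>x. lerch 1 t (1 / 2 + x) - of_int t * lerch 1 t (1 / 2 - x)) has_fps_expansion B"
    unfolding B_def lerch_fps_def lerch_minus_fps_def
    by (intro has_fps_expansion_cmult_left has_fps_expansion_diff
        has_fps_expansion_lerch has_fps_expansion_lerch_minus half_notin_nonpos_Ints) auto
  show "(\<lambda>x. trig_kernel t (half_pole m + x)) has_laurent_expansion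
      fls_const (of_int t ^ m) * fps_to_fls B" for m
  proof -
    have "(\<lambda>x. of_int t ^ m * (lerch 1 t (1 / 2 + x) - of_int t * lerch 1 t (1 / 2 - x)))
        has_laurent_expansion fls_const (of_int t ^ m) * fps_to_fls B"
      by (intro has_laurent_expansion_cmult_left has_laurent_expansion_fps B)
    also have "?this \<longleftrightarrow> ?thesis"
    proof (intro has_laurent_expansion_cong refl)
      have "eventually (\<lambda>z. z \<in> ball 0 (1 / 2) - {0 :: complex}) (at 0)"
        by (intro eventually_at_in_open) auto
      then show "eventually (\<lambda>x. of_int t ^ m *
          (lerch 1 t (1 / 2 + x) - of_int t * lerch 1 t (1 / 2 - x)) =
          trig_kernel t (half_pole m + x)) (at 0)"
      proof eventually_elim
        case (elim x)
        have "1 / 2 + x + of_nat i \<noteq> 0" for i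
        proof
          assume "1 / 2 + x + of_nat i = 0"
          then have "x = - of_real (1 / 2 + real i)" by (simp add: add_eq_0_iff algebra_simps)
          then have "cmod x = 1 / 2 + real i"
            by (simp only: norm_minus_cancel norm_of_real)
          with elim show False by simp
        qed
        from kernel_plus_nat[OF this assms(2), of m]
        have "trig_kernel t (half_pole m + x) = of_int t ^ m * trig_kernel t (1 / 2 + x)"
          by (simp add: half_pole_def add_ac)
        moreover have "1 - (1 / 2 + x) = 1 / 2 - x" by simp
        ultimately show ?case by (simp only: trig_kernel_def)
      qed
    qed
    finally show ?thesis .
  qed
  have "B $ r \<in> lower_algebra k" for r
    unfolding B_def using assms
    by (auto simp del: One_nat_def intro!: lower.mult_mem lower.diff_mem lerch_fps_mem lower.of_int_mem)
  then show "span_R.L k 0 0 (\<lambda>_. fps_to_fls B)"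
    unfolding span_R.L_def by (auto intro!: exI[of _ 0] span_R.E_const span_R.zero)
qed

text \<open>The argument is \<open>- x - m\<close>. Moving it by \<open>m + 1\<close> splits off the
  polar term \<open>(-1) ^ p / x ^ p\<close>, whose coefficient is constant, and \<open>m\<close>
  regular terms, whose Taylor coefficients are multiples of \<open>H_sum (p + r) t m\<close>. Thus a
  harmonic number enters only through the regular part, which is what \<open>L\<close> with degree
  \<open>1\<close> records.\<close>

lemma lerch_expansion_half:
  assumes "1 \<le> k" "1 \<le> p" "t \<in> {1, -1}"
  obtains A where
    "\<And>m. (\<lambda>x. lerch p t (1 / 2 - (half_pole m + x))) has_laurent_expansion
       fls_const (of_int t ^ m) * A m"
    "span_R.L k 1 0 A"
proof
  define B where "B = (\<lambda>m. fps_const (of_int t) * lerch_minus_fps p t 1 +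
    (\<Sum>i=1..m. fps_const ((-1) ^ p * of_int t ^ i) * inverse_power_fps p (of_nat i)))"
  define A where "A = (\<lambda>m. fls_const ((-1) ^ p) * fls_X_intpow (- int p) + fps_to_fls (B m))"
  have tt: "of_int t ^ m * (of_int t ^ m * x) = (x :: complex)" for x m
    using sign_mult_self[OF assms(3)] by (simp flip: mult.assoc power_mult_distrib)
  have mm: "a / ((-1) ^ p * b) = (-1) ^ p * (a / b)" for a b :: complex
    by (cases "even p") auto
  show "(\<lambda>x. lerch p t (1 / 2 - (half_pole m + x))) has_laurent_expansion
       fls_const (of_int t ^ m) * A m" for m
  proof -
    have B: "(\<lambda>x. of_int t * lerch p t (1 - x) +
        (\<Sum>i=1..m. ((-1) ^ p * of_int t ^ i) * (1 / (of_nat i + x) ^ p))) has_fps_expansion B m"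
      unfolding B_def lerch_minus_fps_def inverse_power_fps_def
      by (intro has_fps_expansion_add has_fps_expansion_sum has_fps_expansion_cmult_left
          has_fps_expansion_lerch_minus has_fps_expansion_inverse_power) (use assms in auto)
    have "(\<lambda>x. of_int t ^ m * ((-1) ^ p * x powi (- int p) + (of_int t * lerch p t (1 - x) +
        (\<Sum>i=1..m. ((-1) ^ p * of_int t ^ i) * (1 / (of_nat i + x) ^ p))))) has_laurent_expansion
        fls_const (of_int t ^ m) * A m"
      unfolding A_def
      by (intro has_laurent_expansion_cmult_left has_laurent_expansion_fps B has_laurent_expansion_add
          has_laurent_expansion_fps_X_power_int)
    also have "?this \<longleftrightarrow> ?thesis"
    proof (intro has_laurent_expansion_cong refl)
      have "eventually (\<lambda>z. z \<in> ball 0 1 - {0 :: complex}) (at 0)"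
        by (intro eventually_at_in_open) auto
      then show "eventually (\<lambda>x. of_int t ^ m * ((-1) ^ p * x powi (- int p) + (of_int t * lerch p t (1 - x) +
        (\<Sum>i=1..m. ((-1) ^ p * of_int t ^ i) * (1 / (of_nat i + x) ^ p)))) =
          lerch p t (1 / 2 - (half_pole m + x))) (at 0)"
      proof eventually_elim
        case (elim x)
        have "- x \<noteq> of_nat i" if "i \<in> {1..m}" for i
        proof
          assume "- x = of_nat i"
          then have "cmod x = real i" by (metis norm_minus_cancel norm_of_nat)
          with elim that show False by simp
        qed
        note 1 = lerch_diff_nat[OF assms(2,3) this]
        have 2: "lerch p t (- x) = (-1) ^ p * x powi (- int p) + of_int t * lerch p t (1 - x)"
        proof -
          have "(- x) ^ p = (-1) ^ p * x ^ p" by (simp flip: power_mult_distrib)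
          then have "1 / (- x) ^ p = (-1) ^ p * x powi (- int p)"
            using mm[of 1 "x ^ p"] by (simp add: power_int_minus inverse_eq_divide)
          then show ?thesis using lerch_plus1[of "- x" p t] elim assms by (simp add: add_ac)
        qed
        have 3: "of_int t ^ i / (- x - of_nat i) ^ p = ((-1) ^ p * of_int t ^ i) * (1 / (of_nat i + x) ^ p)"
          for i
        proof -
          have "(- x - of_nat i) ^ p = (-1) ^ p * (of_nat i + x) ^ p"
            by (simp add: add_ac flip: power_mult_distrib)
          then show ?thesis using mm[of "of_int t ^ i"] by simp
        qed
        have "1 / 2 - (half_pole m + x) = - x - of_nat m" by (simp add: half_pole_def)
        then show ?case using 1 tt[of m] unfolding 2 3 by (metis (no_types, lifting) add.assoc)
      qed
    qed
    finally show ?thesis .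
  qed
  show "span_R.L k 1 0 A"
    unfolding span_R.L_def
  proof (intro conjI exI[of _ "- int p"] allI impI)
    fix m i assume "i < - int p"
    then show "A m $$ i = 0" by (simp add: A_def)
  next
    fix i :: int assume "i < 0"
    have "span_R.E k (Suc 0) 0 (\<lambda>_. (-1) ^ p)"
      using lower.power_mem[OF lower.of_int_mem[of "-1"], of p k] by (intro span_R.E_const) simp
    then show "span_R.E k 1 0 (\<lambda>m. A m $$ i)"
      using span_R.zero[of k 1 0] \<open>i < 0\<close> by (cases "i = - int p") (simp_all add: A_def)
  next
    fix i :: int assume i: "0 \<le> i"
    define r where "r = nat i"
    define c :: complex where "c = (-1) ^ r * pochhammer (of_nat p) r / fact r"
    have "A m $$ i = of_int t * lerch_minus_fps p t 1 $ r +
        ((-1) ^ p * c * of_int t) * H_seq (p + r) t m" for m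
    proof -
      have "(\<Sum>i=1..m. (-1) ^ p * of_int t ^ i * (c * (1 / of_nat i ^ (p + r)))) =
            ((-1) ^ p * c * of_int t) * H_seq (p + r) t m"
        unfolding H_seq_def H_sum_def of_real_sum sum_distrib_left
      proof (intro sum.cong refl)
        fix i assume "i \<in> {1..m}"
        then have "of_int t ^ i = (of_int t * of_int t ^ (i - 1) :: complex)"
          by (cases i) auto
        then show "(-1) ^ p * of_int t ^ i * (c * (1 / of_nat i ^ (p + r))) =
          (-1) ^ p * c * of_int t * of_real (of_int t ^ (i - 1) / real i ^ (p + r))"
          by simp
      qed
      then show ?thesis
        using i assms(2) by (simp add: A_def B_def r_def fps_sum_nth inverse_power_fps_def c_def)
    qed
    moreover have "span_R.E k 2 0 (\<lambda>m. of_int t * lerch_minus_fps p t 1 $ r +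
        ((-1) ^ p * c * of_int t) * H_seq (p + r) t m)"
    proof (rule span_R.E_add[OF span_R.E_cmult])
      show "span_R.E k 2 0 (\<lambda>m. H_seq (p + r) t m)"
        using span_R.E_X[of "p + r" t k 0] assms by (simp add: numeral_2_eq_2)
      have "of_int t * lerch_minus_fps p t 1 $ r \<in> lower_algebra k"
        using assms by (intro lower.mult_mem lower.of_int_mem lerch_fps_mem) auto
      then show "span_R.E k 2 0 (\<lambda>m. of_int t * lerch_minus_fps p t 1 $ r)"
        using span_R.E_const[of _ k 1] by (simp add: numeral_2_eq_2)
      show "(-1) ^ p * c * of_int t \<in> lower_algebra k"
        using lower.power_mem[OF lower.of_int_mem[of "-1"], of p k] unfolding c_def
        by (intro lower.mult_mem lower.of_int_mem lower.taylor_coeff_mem) auto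
    qed
    ultimately show "span_R.E k (Suc 1) 0 (\<lambda>m. A m $$ i)" by (simp add: numeral_2_eq_2)
  qed
qed

text \<open>Higher Taylor coefficients only raise the exponent of the denominator, so it stays at
  least \<open>q\<close>.\<close>

lemma inverse_power_expansion_half:
  assumes "1 \<le> q"
  obtains A where
    "\<And>m. (\<lambda>x. 1 / (half_pole m + x) ^ q) has_laurent_expansion A m"
    "span_R.L k 0 q A"
proof
  define A where "A = (\<lambda>m. fps_to_fls (inverse_power_fps q (half_pole m)))"
  show "(\<lambda>x. 1 / (half_pole m + x) ^ q) has_laurent_expansion A m" for m
    unfolding A_def inverse_power_fps_def
    by (intro has_laurent_expansion_fps has_fps_expansion_inverse_power assms)
       (simp add: half_pole_def complex_eq_iff)
  show "span_R.L k 0 q A"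
    unfolding span_R.L_def
  proof (intro conjI exI[of _ 0] allI impI)
    fix i :: int assume i: "0 \<le> i"
    define r where "r = nat i"
    have "span_R.E k 1 q (\<lambda>m. (-1) ^ r * pochhammer (of_nat q) r / fact r *
        (1 / half_pole m ^ (q + r)))"
      using span_R.E_inverse_power[of q "q + r" k 0]
      by (intro span_R.E_cmult lower.taylor_coeff_mem) auto
    then show "span_R.E k (Suc 0) q (\<lambda>m. A m $$ i)"
      using i by (simp add: A_def inverse_power_fps_def r_def)
  qed (auto simp: A_def intro: span_R.zero)
qed

section \<open>Bounds on the contour\<close>

text \<open>
  In the conditionally convergent case \<open>q = 1\<close>, \<open>\<sigma> = -1\<close> the factor \<open>1 / z ^ q\<close> is too large on
  the horizontal sides of the contour; there the decay comes from a factor of the integrand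
  with sign \<open>-1\<close>, of which there is an odd number.
\<close>

definition sign_weight :: "int \<Rightarrow> real \<Rightarrow> real" where
  "sign_weight t y = (if t = -1 then 1 / (1 + \<bar>y\<bar>) else 1)"

lemma sign_weight_nonneg: "0 \<le> sign_weight t y"
  by (simp add: sign_weight_def)

lemma sign_weight_mult:
  assumes "t \<in> {1, -1}" "u \<in> {1, -1}"
  shows "sign_weight t y * sign_weight u y \<le> sign_weight (t * u) y"
proof -
  have "1 / (1 + \<bar>y\<bar>) \<le> 1" by simp
  then have "1 / (1 + \<bar>y\<bar>) \<le> 1 + \<bar>y\<bar>" by linarith
  then show ?thesis using assms by (auto simp: sign_weight_def)
qed

lemma prod_sign:
  assumes "\<And>i. i \<in> I \<Longrightarrow> s i \<in> {1, -1 :: int}"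
  shows "prod s I \<in> {1, -1}"
  using assms
proof (induction I rule: infinite_finite_induct)
  case (insert i I)
  then have "s i \<in> {1, -1}" "prod s I \<in> {1, -1}" by auto
  then show ?case using insert.hyps by auto
qed auto

lemma prod_sign_weight:
  assumes "\<And>i. i \<in> I \<Longrightarrow> s i \<in> {1, -1}"
  shows "(\<Prod>i\<in>I. sign_weight (s i) y) \<le> sign_weight (prod s I) y"
  using assms
proof (induction I rule: infinite_finite_induct)
  case (insert i I)
  have "sign_weight (s i) y * (\<Prod>i\<in>I. sign_weight (s i) y) \<le>
      sign_weight (s i) y * sign_weight (prod s I) y"
    using insert by (intro mult_left_mono sign_weight_nonneg) auto
  also have "\<dots> \<le> sign_weight (s i * prod s I) y"
    using insert.prems by (intro sign_weight_mult prod_sign) auto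
  finally show ?case using insert.hyps by simp
qed (auto simp: sign_weight_def)

lemma norm_lerch_weight_le:
  assumes z: "away_from_Ints z" and n: "1 \<le> n" "2 * cmod z \<le> real n"
    and p: "1 \<le> p" and t: "t \<in> {1, -1}"
  shows "cmod (lerch p t z) \<le> 16 ^ p * 1024 * harm n * sign_weight t (Im z)"
proof -
  have h: "1 \<le> (harm n :: real)"
    using harm_mono[OF n(1), where ?'a = real] by (simp add: harm_def)
  show ?thesis
  proof (cases "(p, t) = (1, 1)")
    case True
    then show ?thesis
      using norm_lerch_1_1_le[OF z n] h by (simp add: sign_weight_def)
  next
    case False
    have "16 ^ p * 1024 / (1 + \<bar>Im z\<bar>) \<le> 16 ^ p * 1024 * sign_weight t (Im z)"
      by (simp add: sign_weight_def divide_simps)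
    also have "\<dots> \<le> 16 ^ p * 1024 * harm n * sign_weight t (Im z)"
      using h sign_weight_nonneg[of t "Im z"] by (intro mult_right_mono) auto
    finally show ?thesis using norm_lerch_le[OF z p t False] by linarith
  qed
qed

text \<open>These are the three arguments at which the integrand evaluates \<open>lerch\<close>. On
  the vertical sides \<open>N + 1/4\<close> has distance \<open>1/4\<close> from the integers and
  from the half-integers; on the horizontal sides the imaginary part suffices.\<close>

lemma on_rectangle_away:
  fixes N Y :: nat
  assumes "1 \<le> Y" "\<bar>Re z\<bar> = real N + 1 / 4 \<or> \<bar>Im z\<bar> = real Y"
  shows "away_from_Ints z" "away_from_Ints (1 - z)" "away_from_Ints (1 / 2 - z)"
proof -
  have *: "1 / 4 \<le> \<bar>x + of_int m\<bar>" if "\<bar>x\<bar> = real N + 1 / 4" for x :: real and m :: int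
  proof (cases "0 \<le> x")
    case True
    then have x: "x = real N + 1 / 4" using that by simp
    have "0 \<le> int N + m \<or> int N + m \<le> -1" by linarith
    then have "0 \<le> real N + of_int m \<or> real N + of_int m \<le> -1"
      by (metis (mono_tags) of_int_0_le_iff of_int_add of_int_le_iff of_int_minus of_int_of_nat_eq of_int_1)
    then show ?thesis unfolding x by linarith
  next
    case False
    then have x: "x = - real N - 1 / 4" using that by simp
    have "0 \<le> int N - m \<or> int N - m \<le> -1" by linarith
    then have "0 \<le> real N - of_int m \<or> real N - of_int m \<le> -1"
      by (metis (mono_tags) of_int_0_le_iff of_int_diff of_int_le_iff of_int_minus of_int_of_nat_eq of_int_1)
    then show ?thesis unfolding x by linarith
  qed
  have 2: "1 / 4 \<le> \<bar>1 - x + of_int m\<bar>" if "\<bar>x\<bar> = real N + 1 / 4" for x :: real and m :: int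
    using *[of "- x" "m + 1"] that by (simp add: algebra_simps)
  have 3: "1 / 4 \<le> \<bar>1 / 2 - x + of_int m\<bar>" if "\<bar>x\<bar> = real N + 1 / 4" for x :: real and m :: int
  proof -
    define j where "j = m + (if 0 \<le> x then - int N else int N)"
    have "1 / 2 - x + of_int m = of_int j + (if 0 \<le> x then 1 / 4 else 3 / 4)"
      using that by (auto simp: j_def)
    moreover have "0 \<le> j \<or> j \<le> -1" by linarith
    then have "0 \<le> real_of_int j \<or> real_of_int j \<le> -1" by linarith
    ultimately show ?thesis by (auto split: if_splits)
  qed
  show "away_from_Ints z" "away_from_Ints (1 - z)" "away_from_Ints (1 / 2 - z)"
    using assms * 2 3 by (auto intro!: away_from_IntsI)
qed

lemma harm_power_over_tendsto_0:
  "(\<lambda>M. harm (8 * M ^ 4) ^ n / real M) \<longlonglongrightarrow> 0"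
proof (rule Lim_null_comparison)
  \<comment> \<open>The choice bounds the \<open>n\<close>-th power by a multiple of
    \<open>(8 * M ^ 4 + 1) powr (1/8)\<close>, of order \<open>sqrt M\<close>, which the division by
    \<open>M\<close> defeats.\<close>
  define \<epsilon> :: real where "\<epsilon> = 1 / (8 * (real n + 1))"
  have \<epsilon>: "0 < \<epsilon>" by (simp add: \<epsilon>_def)
  have \<epsilon>n: "\<epsilon> * real n \<le> 1 / 8" by (simp add: \<epsilon>_def divide_simps)
  define C where "C = (1 + 1 / \<epsilon>) ^ n"
  have C: "0 \<le> C" using \<epsilon> by (simp add: C_def)
  show "\<forall>\<^sub>F M in sequentially. norm (harm (8 * M ^ 4) ^ n / real M) \<le>
          C * (8 * real M ^ 4 + 1) powr (1 / 8) / real M"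
  proof (intro always_eventually allI)
    fix M :: nat
    define x where "x = 8 * real M ^ 4 + 1"
    have x: "1 \<le> x" by (simp add: x_def)
    have "harm (8 * M ^ 4) ^ n \<le> ((1 + 1 / \<epsilon>) * x powr \<epsilon>) ^ n"
      using harm_le_powr[OF \<epsilon>, of "8 * M ^ 4"]
      by (intro power_mono harm_nonneg) (simp_all add: x_def)
    also have "\<dots> = C * x powr (\<epsilon> * real n)"
      using x by (simp add: C_def power_mult_distrib powr_powr flip: powr_realpow)
    also have "\<dots> \<le> C * x powr (1 / 8)"
      using x \<epsilon>n C by (intro mult_left_mono powr_mono) auto
    finally show "norm (harm (8 * M ^ 4) ^ n / real M) \<le>
          C * (8 * real M ^ 4 + 1) powr (1 / 8) / real M"
      by (simp add: x_def harm_nonneg divide_right_mono)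
  qed
  show "(\<lambda>M. C * (8 * real M ^ 4 + 1) powr (1 / 8) / real M) \<longlonglongrightarrow> 0"
    by real_asymp
qed

section \<open>The residue identity\<close>

locale euler_kernel =
  fixes k q :: nat and p :: "nat \<Rightarrow> nat" and s :: "nat \<Rightarrow> int" and \<sigma> :: int
  assumes k: "1 \<le> k" and p: "\<And>i. i \<in> {1..k} \<Longrightarrow> 1 \<le> p i" and q: "1 \<le> q"
    and s: "\<And>i. i \<in> {1..k} \<Longrightarrow> s i \<in> {1, -1}" and \<sigma>: "\<sigma> \<in> {1, -1}"
    and q_\<sigma>: "(q, \<sigma>) \<noteq> (1, 1)"
begin

text \<open>
  At the integers the factor \<open>lerch (p i) (s i) (1 / 2 - z)\<close> contributes the sign
  \<open>s i ^ n\<close>, which the sign of the trigonometric kernel has to compensate.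
\<close>

definition \<tau> :: int where "\<tau> = \<sigma> * (\<Prod>i=1..k. s i)"

definition f :: "complex \<Rightarrow> complex" where
  "f z = trig_kernel \<tau> z * (\<Prod>i=1..k. lerch (p i) (s i) (1 / 2 - z)) * (1 / z ^ q)"

lemma prod_s: "(\<Prod>i=1..k. s i) \<in> {1, -1}"
  using s by (rule prod_sign)

lemma \<tau>_sign: "\<tau> \<in> {1, -1}"
  using \<sigma> prod_s by (auto simp: \<tau>_def)

lemma \<tau>_power: "of_int \<tau> ^ m * (\<Prod>i=1..k. of_int (s i) ^ m) = (of_int \<sigma> ^ m :: complex)"
proof -
  have "\<tau> * (\<Prod>i=1..k. s i) = \<sigma>" using prod_s by (auto simp: \<tau>_def)
  then show ?thesis
    by (metis of_int_mult of_int_prod power_mult_distrib prod_power_distrib)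
qed

lemma half_minus_notin:
  assumes "z \<notin> range half_pole"
  shows "1 / 2 - z \<notin> \<int>\<^sub>\<le>\<^sub>0"
proof
  assume "1 / 2 - z \<in> \<int>\<^sub>\<le>\<^sub>0"
  then obtain n where "1 / 2 - z = - of_nat n" by (elim nonpos_Ints_cases')
  then have "z = half_pole n" by (simp add: half_pole_def algebra_simps)
  with assms show False by blast
qed

lemma holomorphic_on_f:
  assumes "A \<inter> \<int> = {}" "A \<inter> range half_pole = {}"
  shows "f holomorphic_on A"
proof -
  have "z \<noteq> 0" if "z \<in> A" for z using assms(1) that by auto
  moreover have "1 / 2 - z \<notin> \<int>\<^sub>\<le>\<^sub>0" if "z \<in> A" for z
    using assms(2) that by (intro half_minus_notin) auto
  ultimately show ?thesis
    unfolding f_def[abs_def] using assms p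
    by (intro holomorphic_intros holomorphic_on_kernel) auto
qed

text \<open>The degrees of the factors add to \<open>0 + k + 0\<close>, but a residue is a polar
  coefficient, so its degree is below \<open>k\<close>. The signs pulled out of the kernel and the
  factors multiply to \<open>\<sigma> ^ m\<close>.\<close>

lemma residue_half_pole:
  obtains e where "span_R.E k k q e" "\<And>m. residue f (half_pole m) = of_int \<sigma> ^ m * e m"
proof -
  obtain A where A: "\<And>m. (\<lambda>x. trig_kernel \<tau> (half_pole m + x)) has_laurent_expansion
      fls_const (of_int \<tau> ^ m) * A" "span_R.L k 0 0 (\<lambda>_. A)"
    using kernel_expansion_half[OF k \<tau>_sign] by blast
  have "\<forall>i\<in>{1..k}. \<exists>B. (\<forall>m. (\<lambda>x. lerch (p i) (s i) (1 / 2 - (half_pole m + x)))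
      has_laurent_expansion fls_const (of_int (s i) ^ m) * B m) \<and> span_R.L k 1 0 B"
    using lerch_expansion_half[OF k p s] by metis
  then obtain B where B: "\<And>i m. i \<in> {1..k} \<Longrightarrow> (\<lambda>x. lerch (p i) (s i) (1 / 2 - (half_pole m + x)))
      has_laurent_expansion fls_const (of_int (s i) ^ m) * B i m"
      "\<And>i. i \<in> {1..k} \<Longrightarrow> span_R.L k 1 0 (B i)"
    by metis
  obtain Q where Q: "\<And>m. (\<lambda>x. 1 / (half_pole m + x) ^ q) has_laurent_expansion Q m"
      "span_R.L k 0 q Q"
    using inverse_power_expansion_half[OF q] by blast
  define e where "e = (\<lambda>m. (A * (\<Prod>i=1..k. B i m) * Q m) $$ (- 1))"
  have "span_R.L k (card {1..k}) 0 (\<lambda>m. \<Prod>i=1..k. B i m)"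
    using B(2) by (intro span_R.L_prod) auto
  then have "span_R.L k (0 + k + 0) (0 + 0 + q) (\<lambda>m. A * (\<Prod>i=1..k. B i m) * Q m)"
    by (intro span_R.L_mult A Q) simp
  from span_R.L_polar[OF this, of "- 1"] have "span_R.E k k q e"
    by (simp add: e_def)
  moreover have "residue f (half_pole m) = of_int \<sigma> ^ m * e m" for m
  proof -
    have const: "(\<Prod>i\<in>I. fls_const (c i)) = fls_const (\<Prod>i\<in>I. c i :: complex)" for I :: "nat set" and c
      by (induction I rule: infinite_finite_induct) auto
    have "(\<lambda>x. f (half_pole m + x)) has_laurent_expansion
        (fls_const (of_int \<tau> ^ m) * A) * (\<Prod>i=1..k. fls_const (of_int (s i) ^ m) * B i m) * Q m"
      unfolding f_def by (intro has_laurent_expansion_mult has_laurent_expansion_prod A B Q)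
    also have "(fls_const (of_int \<tau> ^ m) * A) * (\<Prod>i=1..k. fls_const (of_int (s i) ^ m) * B i m) * Q m =
        (fls_const (of_int \<tau> ^ m) * fls_const (\<Prod>i=1..k. of_int (s i) ^ m)) *
        (A * (\<Prod>i=1..k. B i m) * Q m)"
      unfolding prod.distrib const by (simp only: mult_ac)
    also have "\<dots> = fls_const (of_int \<sigma> ^ m) * (A * (\<Prod>i=1..k. B i m) * Q m)"
      unfolding fls_const_mult_const \<tau>_power ..
    finally show ?thesis
      using has_laurent_expansion_residue by (fastforce simp: e_def)
  qed
  ultimately show ?thesis by (rule that)
qed

lemma residue_0_mem: "residue f 0 \<in> lower_algebra k"
proof -
  obtain A where A: "trig_kernel \<tau> has_laurent_expansion A" "\<And>i. A $$ i \<in> lower_algebra k"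
    using kernel_expansion_0[OF k \<tau>_sign] by blast
  define B where "B = (\<lambda>i. fps_to_fls (lerch_minus_fps (p i) (s i) (1 / 2)))"
  have B: "(\<lambda>x. lerch (p i) (s i) (1 / 2 - x)) has_laurent_expansion B i" if "i \<in> {1..k}" for i
    unfolding B_def lerch_minus_fps_def using p[OF that]
    by (intro has_laurent_expansion_fps has_fps_expansion_lerch_minus half_notin_nonpos_Ints)
  have "(\<lambda>z. 1 / z ^ q) has_laurent_expansion fls_X_intpow (- int q)"
    using has_laurent_expansion_fps_X_power_int[of "- int q"]
    by (simp add: power_int_minus inverse_eq_divide)
  then have "f has_laurent_expansion A * (\<Prod>i=1..k. B i) * fls_X_intpow (- int q)"
    unfolding f_def[abs_def]
    by (intro has_laurent_expansion_mult has_laurent_expansion_prod A B)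
  then have f: "(\<lambda>x. f (0 + x)) has_laurent_expansion A * (\<Prod>i=1..k. B i) * fls_X_intpow (- int q)"
    by simp
  have "(A * (\<Prod>i=1..k. B i) * fls_X_intpow (- int q)) $$ i \<in> lower_algebra k" for i
    using k p s unfolding B_def
    by (intro lower.fls_times_mem lower.fls_prod_mem A fls_X_intpow_mem fps_to_fls_mem lerch_fps_mem)
       auto
  then show ?thesis
    unfolding has_laurent_expansion_residue[OF f] fls_residue_def .
qed

lemma int_notin_half_pole: "of_int n \<notin> range half_pole"
  using half_notin_Ints by (metis Ints_of_int half_pole_def imageE)

text \<open>Only the kernel is singular at a nonzero integer, with a simple pole, so the other
  factors are just evaluated there.\<close>

lemma residue_int:
  assumes "n \<noteq> 0"
  shows "residue f (of_int n) = of_int \<tau> ^ nat \<bar>n\<bar> *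
    (\<Prod>i=1..k. lerch (p i) (s i) (1 / 2 - of_int n)) * (1 / of_int n ^ q)"
proof (rule residue_simple'[of "ball (of_int n) (1 / 2)"])
  show "f holomorphic_on ball (of_int n) (1 / 2) - {of_int n}"
  proof (rule holomorphic_on_f)
    have "z = of_int n" if z: "z \<in> ball (of_int n) (1 / 2)" "z \<in> \<int>" for z :: complex
    proof -
      obtain j where j: "z = of_int j" using z(2) by (elim Ints_cases)
      have "cmod (of_int (n - j)) < 1 / 2" using z(1) by (simp add: j dist_norm)
      then have "\<bar>real_of_int (n - j)\<bar> < 1 / 2" by (simp only: norm_of_int)
      then have "n = j" by linarith
      then show ?thesis by (simp add: j)
    qed
    then show "(ball (of_int n) (1 / 2) - {of_int n :: complex}) \<inter> \<int> = {}" by blast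
    have False if "half_pole m \<in> ball (of_int n) (1 / 2)" for m
    proof -
      have "half_pole m - of_int n = of_real (real_of_int (int m - n) + 1 / 2)"
        by (simp add: half_pole_def)
      then have "\<bar>real_of_int (int m - n) + 1 / 2\<bar> < 1 / 2"
        using that by (metis dist_norm mem_ball dist_commute norm_of_real)
      moreover have "\<not> \<bar>real_of_int j + 1 / 2\<bar> < 1 / 2" for j
      proof -
        have "0 \<le> j \<or> j \<le> -1" by linarith
        then have "0 \<le> real_of_int j \<or> real_of_int j \<le> -1" by linarith
        then show ?thesis by auto
      qed
      ultimately show False by blast
    qed
    then show "(ball (of_int n) (1 / 2) - {of_int n :: complex}) \<inter> range half_pole = {}" by blast
  qed
  have "isCont (\<lambda>z. lerch (p i) (s i) (1 / 2 - z)) (of_int n)" if "i \<in> {1..k}" for i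
    by (rule isCont_o2[OF _ DERIV_isCont[OF has_field_derivative_lerch]])
       (use p[OF that] half_minus_notin[OF int_notin_half_pole] in \<open>auto intro!: continuous_intros\<close>)
  then have "isCont (\<lambda>z. (\<Prod>i=1..k. lerch (p i) (s i) (1 / 2 - z)) * (1 / z ^ q)) (of_int n)"
    using assms by (intro continuous_intros) auto
  then have "(\<lambda>z. (trig_kernel \<tau> z * (z - of_int n)) *
      ((\<Prod>i=1..k. lerch (p i) (s i) (1 / 2 - z)) * (1 / z ^ q))) \<midarrow>of_int n\<rightarrow>
      of_int \<tau> ^ nat \<bar>n\<bar> * ((\<Prod>i=1..k. lerch (p i) (s i) (1 / 2 - of_int n)) * (1 / of_int n ^ q))"
    unfolding isCont_def by (rule tendsto_mult[OF tendsto_kernel_int[OF \<tau>_sign]])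
  then show "(\<lambda>z. f z * (z - of_int n)) \<midarrow>of_int n\<rightarrow> of_int \<tau> ^ nat \<bar>n\<bar> *
      (\<Prod>i=1..k. lerch (p i) (s i) (1 / 2 - of_int n)) * (1 / of_int n ^ q)"
    by (simp add: f_def mult_ac)
qed auto

lemma residues_pair:
  "residue f (of_int (int m + 1)) + residue f (of_int (- (int m + 1))) =
   of_int \<sigma> ^ (m + 1) * (1 / nat_pole m ^ q) *
   ((\<Prod>i=1..k. lerch (p i) (s i) (1 / 2) + (-1) ^ p i * of_int (s i) * h_seq (p i) (s i) m) +
    (-1) ^ q * (\<Prod>i=1..k. lerch (p i) (s i) (1 / 2) + - 1 * h_seq (p i) (s i) m))"
proof -
  have nat: "nat \<bar>int m + 1\<bar> = m + 1" "nat \<bar>- (int m + 1)\<bar> = m + 1" by auto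
  have pos: "of_int (int m + 1) = (of_nat (m + 1) :: complex)"
    and neg: "of_int (- (int m + 1)) = (- of_nat (m + 1) :: complex)" by simp_all
  have "residue f (of_int (int m + 1)) =
      of_int \<tau> ^ (m + 1) * (\<Prod>i=1..k. of_int (s i) ^ (m + 1) *
        (lerch (p i) (s i) (1 / 2) + (-1) ^ p i * of_int (s i) * h_seq (p i) (s i) m)) *
      (1 / nat_pole m ^ q)"
    using residue_int[of "int m + 1"] p s unfolding nat pos nat_pole_def h_seq_def
    by (simp add: lerch_half_minus_nat del: of_nat_Suc of_nat_add power_Suc)
  also have "\<dots> = of_int \<sigma> ^ (m + 1) * (1 / nat_pole m ^ q) *
      (\<Prod>i=1..k. lerch (p i) (s i) (1 / 2) + (-1) ^ p i * of_int (s i) * h_seq (p i) (s i) m)"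
    unfolding prod.distrib \<tau>_power[of "m + 1", symmetric] by (simp only: mult_ac)
  finally have 1: "residue f (of_int (int m + 1)) = \<dots>" .
  have sq: "a / ((-1) ^ q * b) = (-1) ^ q * (a / b)" for a b :: complex
    by (cases "even q") auto
  have "(- of_nat (m + 1)) ^ q = (-1) ^ q * nat_pole m ^ q"
    by (simp add: nat_pole_def flip: power_mult_distrib)
  then have np: "1 / (- of_nat (m + 1)) ^ q = (-1) ^ q * (1 / nat_pole m ^ q)"
    by (simp only: sq)
  have "residue f (of_int (- (int m + 1))) =
      of_int \<tau> ^ (m + 1) * (\<Prod>i=1..k. of_int (s i) ^ (m + 1) *
        (lerch (p i) (s i) (1 / 2) + - 1 * h_seq (p i) (s i) m)) *
      ((-1) ^ q * (1 / nat_pole m ^ q))"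
    using residue_int[of "- (int m + 1)"] p s unfolding nat neg np h_seq_def
    by (simp add: lerch_half_plus_nat del: of_nat_Suc of_nat_add power_Suc)
  also have "\<dots> = of_int \<sigma> ^ (m + 1) * (1 / nat_pole m ^ q) *
      ((-1) ^ q * (\<Prod>i=1..k. lerch (p i) (s i) (1 / 2) + - 1 * h_seq (p i) (s i) m))"
    unfolding prod.distrib \<tau>_power[of "m + 1", symmetric] by (simp only: mult_ac)
  finally show ?thesis unfolding 1 by (simp only: distrib_left)
qed

text \<open>One logarithm comes from the kernel and one from each of the \<open>k\<close> factors.
  The index \<open>8 * N\<close> exceeds twice the modulus of all three arguments because
  \<open>Y \<le> N\<close>, and \<open>32768 = 2 * 16 * 1024\<close> counts the two
  \<open>lerch\<close> terms of the kernel.\<close>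

lemma norm_f_le:
  obtains C where "0 \<le> C"
    "\<And>N Y z. 1 \<le> Y \<Longrightarrow> Y \<le> N \<Longrightarrow> \<bar>Re z\<bar> \<le> real N + 1 / 4 \<Longrightarrow> \<bar>Im z\<bar> \<le> real Y \<Longrightarrow>
       \<bar>Re z\<bar> = real N + 1 / 4 \<or> \<bar>Im z\<bar> = real Y \<Longrightarrow>
       cmod (f z) \<le> C * harm (8 * N) ^ (k + 1) * sign_weight \<sigma> (Im z) / cmod z ^ q"
proof
  define c where "c = (\<lambda>i. 16 ^ p i * 1024 :: real)"
  define C where "C = 32768 * (\<Prod>i=1..k. c i)"
  show "0 \<le> C" by (auto simp: C_def c_def intro!: prod_nonneg)
  fix N Y :: nat and z
  assume NY: "1 \<le> Y" "Y \<le> N" and z: "\<bar>Re z\<bar> \<le> real N + 1 / 4" "\<bar>Im z\<bar> \<le> real Y"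
    and bd: "\<bar>Re z\<bar> = real N + 1 / 4 \<or> \<bar>Im z\<bar> = real Y"
  define H where "H = (harm (8 * N) :: real)"
  define w where "w = (\<lambda>t. sign_weight t (Im z))"
  have H: "0 \<le> H" by (simp add: H_def harm_nonneg)
  have "cmod z \<le> real N + 1 / 4 + real Y"
    using cmod_le[of z] z by linarith
  then have z3: "cmod z \<le> 2 * real N + 1 / 4" using NY by linarith
  have "1 \<le> real N" using NY by linarith
  have cz: "2 * cmod z \<le> real (8 * N)" using z3 \<open>1 \<le> real N\<close> by simp
  have c1: "2 * cmod (1 - z) \<le> real (8 * N)"
    using norm_triangle_ineq4[of 1 z] z3 \<open>1 \<le> real N\<close> by simp
  have ch: "2 * cmod (1 / 2 - z) \<le> real (8 * N)"
    using norm_triangle_ineq4[of "1 / 2" z] z3 \<open>1 \<le> real N\<close> by (simp add: norm_divide)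
  have n1: "1 \<le> 8 * N" using NY by simp
  note away = on_rectangle_away[OF NY(1) bd]
  have wIm: "sign_weight t (Im (1 - z)) = w t" "sign_weight t (Im (1 / 2 - z)) = w t" for t
    by (simp_all add: w_def sign_weight_def)
  have K: "cmod (trig_kernel \<tau> z) \<le> 32768 * H * w \<tau>"
  proof -
    have "cmod (trig_kernel \<tau> z) \<le> cmod (lerch 1 \<tau> z) + cmod (lerch 1 \<tau> (1 - z))"
      using norm_triangle_ineq4[of "lerch 1 \<tau> z" "of_int \<tau> * lerch 1 \<tau> (1 - z)"] \<tau>_sign
      by (auto simp: trig_kernel_def norm_mult)
    also have "cmod (lerch 1 \<tau> z) \<le> 16 ^ 1 * 1024 * H * w \<tau>"
      unfolding H_def w_def by (rule norm_lerch_weight_le[OF away(1) n1 cz _ \<tau>_sign]) simp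
    also have "cmod (lerch 1 \<tau> (1 - z)) \<le> 16 ^ 1 * 1024 * H * w \<tau>"
      unfolding H_def wIm[symmetric] by (rule norm_lerch_weight_le[OF away(2) n1 c1 _ \<tau>_sign]) simp
    finally show ?thesis by simp
  qed
  have "cmod (\<Prod>i=1..k. lerch (p i) (s i) (1 / 2 - z)) \<le> (\<Prod>i=1..k. c i * H * w (s i))"
    unfolding prod_norm[symmetric]
  proof (rule prod_mono)
    fix i assume i: "i \<in> {1..k}"
    show "0 \<le> cmod (lerch (p i) (s i) (1 / 2 - z)) \<and>
        cmod (lerch (p i) (s i) (1 / 2 - z)) \<le> c i * H * w (s i)"
      using norm_lerch_weight_le[OF away(3) n1 ch p[OF i] s[OF i]] unfolding wIm c_def H_def by simp
  qed
  also have "\<dots> = (\<Prod>i=1..k. c i) * H ^ k * (\<Prod>i=1..k. w (s i))"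
    by (simp add: prod.distrib)
  finally have P: "cmod (\<Prod>i=1..k. lerch (p i) (s i) (1 / 2 - z)) \<le> \<dots>" .
  \<comment> \<open>Weights of signs multiply to at most the weight of the product sign, and \<tau>
    was chosen so that this product is \<sigma>.\<close>
  have "w \<tau> * (\<Prod>i=1..k. w (s i)) \<le> w \<tau> * w (\<Prod>i=1..k. s i)"
    unfolding w_def by (intro mult_left_mono prod_sign_weight s sign_weight_nonneg)
  also have "\<dots> \<le> w (\<tau> * (\<Prod>i=1..k. s i))"
    unfolding w_def by (rule sign_weight_mult[OF \<tau>_sign prod_s])
  also have "\<tau> * (\<Prod>i=1..k. s i) = \<sigma>" using prod_s by (auto simp: \<tau>_def)
  finally have W: "w \<tau> * (\<Prod>i=1..k. w (s i)) \<le> w \<sigma>" .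
  have "cmod (trig_kernel \<tau> z * (\<Prod>i=1..k. lerch (p i) (s i) (1 / 2 - z))) \<le>
      (32768 * H * w \<tau>) * ((\<Prod>i=1..k. c i) * H ^ k * (\<Prod>i=1..k. w (s i)))"
    unfolding norm_mult using H by (intro mult_mono K P) (auto simp: w_def sign_weight_nonneg)
  also have "\<dots> = C * H ^ (k + 1) * (w \<tau> * (\<Prod>i=1..k. w (s i)))"
    by (simp add: C_def mult_ac)
  also have "\<dots> \<le> C * H ^ (k + 1) * w \<sigma>"
    using H \<open>0 \<le> C\<close> by (intro mult_left_mono W) auto
  finally have "cmod (trig_kernel \<tau> z * (\<Prod>i=1..k. lerch (p i) (s i) (1 / 2 - z))) \<le>
      C * H ^ (k + 1) * w \<sigma>" .
  then have "cmod (trig_kernel \<tau> z * (\<Prod>i=1..k. lerch (p i) (s i) (1 / 2 - z))) / cmod z ^ q \<le>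
      C * H ^ (k + 1) * w \<sigma> / cmod z ^ q"
    by (rule divide_right_mono) simp
  moreover have "cmod (f z) =
      cmod (trig_kernel \<tau> z * (\<Prod>i=1..k. lerch (p i) (s i) (1 / 2 - z))) / cmod z ^ q"
    by (simp add: f_def norm_mult norm_divide norm_power)
  ultimately show "cmod (f z) \<le> C * harm (8 * N) ^ (k + 1) * sign_weight \<sigma> (Im z) / cmod z ^ q"
    unfolding H_def w_def by simp
qed

section \<open>The contour integral and its limit\<close>

definition residue_sum :: "nat \<Rightarrow> complex" where
  "residue_sum N = residue f 0 +
     (\<Sum>m<N. residue f (of_int (int m + 1)) + residue f (of_int (- (int m + 1)))) +
     (\<Sum>m<N. residue f (half_pole m))"

lemma contour_integral_f:
  fixes N Y :: nat
  assumes "1 \<le> Y"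
  defines "a \<equiv> Complex (- (real N + 1 / 4)) (- real Y)" and "b \<equiv> Complex (real N + 1 / 4) (real Y)"
  shows "contour_integral (rectpath a b) f = 2 * pi * \<i> * residue_sum N"
    and "continuous_on (path_image (rectpath a b)) f"
proof -
  \<comment> \<open>The residue theorem needs an open set around the rectangle without further
    poles; \<open>3/8\<close> lies strictly between the side at offset \<open>1/4\<close> and the
    next pole at offset \<open>1/2\<close>.\<close>
  define S where "S = box (Complex (- (real N + 3 / 8)) (- real Y - 1)) (Complex (real N + 3 / 8) (real Y + 1))"
  define Z where "Z = (of_int ` {- int N..int N} :: complex set)"
  define P where "P = half_pole ` {..<N}"
  have ab: "Re a \<le> Re b" "Im a \<le> Im b" by (simp_all add: a_def b_def)
  have sub: "Z \<union> P \<subseteq> box a b"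
    using assms(1) by (auto simp: Z_def P_def in_box_complex_iff a_def b_def half_pole_def)
  have cb: "cbox a b \<subseteq> S"
    by (auto simp: S_def in_box_complex_iff in_cbox_complex_iff a_def b_def)
  have img: "path_image (rectpath a b) \<subseteq> S - (Z \<union> P)"
    using path_image_rectpath_cbox_minus_box[OF ab] sub cb by blast
  have ZS: "z \<in> Z" if z: "z \<in> S" "z \<in> \<int>" for z
  proof -
    obtain j where j: "z = of_int j" using z(2) by (elim Ints_cases)
    have "- (real N + 3 / 8) < real_of_int j" "real_of_int j < real N + 3 / 8"
      using z(1) by (auto simp: S_def j in_box_complex_iff)
    then have "- int N \<le> j" "j \<le> int N" by linarith+
    then show ?thesis by (simp add: Z_def j)
  qed
  have PS: "half_pole m \<in> P" if "half_pole m \<in> S" for m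
  proof -
    have "real m + 1 / 2 < real N + 3 / 8"
      using that by (auto simp: S_def in_box_complex_iff half_pole_def)
    then have "m < N" by linarith
    then show ?thesis by (simp add: P_def)
  qed
  have holo: "f holomorphic_on S - (Z \<union> P)"
    by (rule holomorphic_on_f) (use ZS PS in auto)
  then show "continuous_on (path_image (rectpath a b)) f"
    using img holomorphic_on_imp_continuous_on holomorphic_on_subset by blast
  have "contour_integral (rectpath a b) f =
      2 * pi * \<i> * (\<Sum>z\<in>Z \<union> P. winding_number (rectpath a b) z * residue f z)"
  proof (rule Residue_theorem[OF _ _ _ holo])
    show "open S" "connected S"
      by (auto simp: S_def intro!: convex_connected)
    show "\<forall>z. z \<notin> S \<longrightarrow> winding_number (rectpath a b) z = 0"
      using winding_number_rectpath_outside[OF ab] cb by blast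
  qed (use img in \<open>auto simp: Z_def P_def\<close>)
  also have "(\<Sum>z\<in>Z \<union> P. winding_number (rectpath a b) z * residue f z) = (\<Sum>z\<in>Z \<union> P. residue f z)"
    using sub winding_number_rectpath by (intro sum.cong refl) auto
  also have "\<dots> = (\<Sum>z\<in>Z. residue f z) + (\<Sum>z\<in>P. residue f z)"
    using int_notin_half_pole by (intro sum.union_disjoint) (auto simp: Z_def P_def)
  also have "(\<Sum>z\<in>P. residue f z) = (\<Sum>m<N. residue f (half_pole m))"
    unfolding P_def by (subst sum.reindex) (auto simp: inj_on_def half_pole_def)
  also have "(\<Sum>z\<in>Z. residue f z) = (\<Sum>n=- int N..int N. residue f (of_int n))"
    unfolding Z_def by (subst sum.reindex) (auto simp: inj_on_def)
  also have "\<dots> = residue f 0 + (\<Sum>m<N. residue f (of_int (int m + 1)) + residue f (of_int (- (int m + 1))))"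
  proof (induction N)
    case (Suc N)
    have "{- int (Suc N)..int (Suc N)} = insert (int N + 1) (insert (- (int N + 1)) {- int N..int N})"
      by auto
    then show ?case using Suc by (simp add: add_ac)
  qed simp
  finally show "contour_integral (rectpath a b) f = 2 * pi * \<i> * residue_sum N"
    by (simp add: residue_sum_def add_ac)
qed

lemma residue_sum_tendsto_0: "(\<lambda>M. residue_sum (M ^ 4)) \<longlonglongrightarrow> 0"
proof -
  obtain C where C: "0 \<le> C"
    "\<And>N Y z. 1 \<le> Y \<Longrightarrow> Y \<le> N \<Longrightarrow> \<bar>Re z\<bar> \<le> real N + 1 / 4 \<Longrightarrow> \<bar>Im z\<bar> \<le> real Y \<Longrightarrow>
       \<bar>Re z\<bar> = real N + 1 / 4 \<or> \<bar>Im z\<bar> = real Y \<Longrightarrow>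
       cmod (f z) \<le> C * harm (8 * N) ^ (k + 1) * sign_weight \<sigma> (Im z) / cmod z ^ q"
    using norm_f_le by blast
  have bound: "cmod (2 * pi * \<i> * residue_sum (M ^ 4)) \<le> 10 * C * (harm (8 * M ^ 4) ^ (k + 1) / real M)"
    if M: "1 \<le> M" for M
  proof -
    \<comment> \<open>The vertical sides contribute \<open>Y / N\<close> and the horizontal ones \<open>N / Y\<^sup>2\<close>, up to logarithms.\<close>
    define N Y where "N = M ^ 4" and "Y = M ^ 3"
    have NY: "1 \<le> Y" "Y \<le> N" "1 \<le> N" using M by (auto simp: N_def Y_def intro!: power_increasing)
    then have rNY: "1 \<le> real Y" "real Y \<le> real N" "1 \<le> real N" by auto
    define H where "H = C * harm (8 * N) ^ (k + 1)"
    have H: "0 \<le> H" using C(1) by (simp add: H_def harm_nonneg)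
    define a b where "a = Complex (- (real N + 1 / 4)) (- real Y)" and "b = Complex (real N + 1 / 4) (real Y)"
    define a' b' where "a' = Complex (Re b) (Im a)" and "b' = Complex (Re a) (Im b)"
    note int = contour_integral_f[OF NY(1), of N, folded a_def b_def]
    have w1: "sign_weight \<sigma> y \<le> 1" for y by (simp add: sign_weight_def)
    have vert: "cmod (f z) \<le> H / real N" if "\<bar>Re z\<bar> = real N + 1 / 4" "\<bar>Im z\<bar> \<le> real Y" for z
    proof -
      have "cmod (f z) \<le> H * sign_weight \<sigma> (Im z) / cmod z ^ q"
        unfolding H_def using that by (intro C(2)[OF NY(1,2)]) auto
      also have "\<dots> \<le> H * 1 / real N"
      proof (intro frac_le mult_left_mono w1 H)
        have "real N \<le> cmod z" using abs_Re_le_cmod[of z] that by simp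
        also have "cmod z ^ 1 \<le> cmod z ^ q" using calculation rNY q by (intro power_increasing) auto
        finally show "real N \<le> cmod z ^ q" by simp
      qed (use rNY H in auto)
      finally show ?thesis by simp
    qed
    have hor: "cmod (f z) \<le> H / real Y ^ 2" if "\<bar>Im z\<bar> = real Y" "\<bar>Re z\<bar> \<le> real N + 1 / 4" for z
    proof -
      have Yz: "real Y \<le> cmod z" using abs_Im_le_cmod[of z] that by simp
      have "cmod (f z) \<le> H * sign_weight \<sigma> (Im z) / cmod z ^ q"
        unfolding H_def using that by (intro C(2)[OF NY(1,2)]) auto
      also have "\<dots> \<le> H / real Y ^ 2"
      proof (cases "q = 1")
        case True
        then have "\<sigma> = -1" using \<sigma> q_\<sigma> by auto
        then have "sign_weight \<sigma> (Im z) \<le> 1 / real Y"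
          using that rNY by (simp add: sign_weight_def frac_le)
        then have "H * sign_weight \<sigma> (Im z) / cmod z ^ q \<le> H * (1 / real Y) / real Y"
          using True Yz rNY H by (intro frac_le mult_left_mono) auto
        then show ?thesis by (simp add: power2_eq_square)
      next
        case False
        then have "2 \<le> q" using q by simp
        have "real Y ^ 2 \<le> cmod z ^ 2" using Yz by (intro power_mono) auto
        also have "\<dots> \<le> cmod z ^ q" using Yz rNY \<open>2 \<le> q\<close> by (intro power_increasing) auto
        finally have "H * sign_weight \<sigma> (Im z) / cmod z ^ q \<le> H * 1 / real Y ^ 2"
          using rNY H by (intro frac_le mult_left_mono w1) auto
        then show ?thesis by simp
      qed
      finally show ?thesis .
    qed
    have img: "path_image (rectpath a b) = closed_segment a a' \<union> closed_segment a' b \<union>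
        closed_segment b b' \<union> closed_segment b' a"
      unfolding rectpath_def Let_def a'_def b'_def by (simp add: path_image_join Un_assoc)
    have ci: "f contour_integrable_on linepath u v" if "closed_segment u v \<subseteq> path_image (rectpath a b)" for u v
      using int(2) that by (intro contour_integrable_continuous_linepath continuous_on_subset[OF int(2)])
    have seg: "closed_segment a a' \<subseteq> path_image (rectpath a b)" "closed_segment a' b \<subseteq> path_image (rectpath a b)"
      "closed_segment b b' \<subseteq> path_image (rectpath a b)" "closed_segment b' a \<subseteq> path_image (rectpath a b)"
      unfolding img by auto
    note cis = seg[THEN ci]
    have I: "contour_integral (rectpath a b) f =
        contour_integral (linepath a a') f + (contour_integral (linepath a' b) f +
        (contour_integral (linepath b b') f + contour_integral (linepath b' a) f))"
      unfolding rectpath_def Let_def a'_def[symmetric] b'_def[symmetric]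
      using cis by (simp add: contour_integral_join contour_integrable_joinI)
    have hb: "cmod (contour_integral (linepath u v) f) \<le> H / real Y ^ 2 * cmod (v - u)"
      if "closed_segment u v \<subseteq> path_image (rectpath a b)"
        "closed_segment u v \<subseteq> {z. \<bar>Im z\<bar> = real Y \<and> \<bar>Re z\<bar> \<le> real N + 1 / 4}" for u v
      using that H rNY by (intro contour_integral_bound_linepath ci hor) auto
    have vb: "cmod (contour_integral (linepath u v) f) \<le> H / real N * cmod (v - u)"
      if "closed_segment u v \<subseteq> path_image (rectpath a b)"
        "closed_segment u v \<subseteq> {z. \<bar>Re z\<bar> = real N + 1 / 4 \<and> \<bar>Im z\<bar> \<le> real Y}" for u v
      using that H rNY by (intro contour_integral_bound_linepath ci vert) auto
    have len: "cmod (a' - a) \<le> 3 * real N" "cmod (b' - b) \<le> 3 * real N"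
        "cmod (b - a') = 2 * real Y" "cmod (a - b') = 2 * real Y"
      using rNY by (auto simp: a_def b_def a'_def b'_def cmod_def real_sqrt_mult)
    have "cmod (contour_integral (linepath a a') f) \<le> H / real Y ^ 2 * (3 * real N)"
      by (rule order_trans[OF hb[OF seg(1)] mult_left_mono[OF len(1)]])
         (use H in \<open>auto simp: a_def a'_def b_def closed_segment_same_Im closed_segment_eq_real_ivl\<close>)
    moreover have "cmod (contour_integral (linepath b b') f) \<le> H / real Y ^ 2 * (3 * real N)"
      by (rule order_trans[OF hb[OF seg(3)] mult_left_mono[OF len(2)]])
         (use H in \<open>auto simp: a_def b'_def b_def closed_segment_same_Im closed_segment_eq_real_ivl\<close>)
    moreover have "cmod (contour_integral (linepath a' b) f) \<le> H / real N * (2 * real Y)"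
      by (rule order_trans[OF vb[OF seg(2)] mult_left_mono[OF eq_refl[OF len(3)]]])
         (use H in \<open>auto simp: a_def a'_def b_def closed_segment_same_Re closed_segment_eq_real_ivl\<close>)
    moreover have "cmod (contour_integral (linepath b' a) f) \<le> H / real N * (2 * real Y)"
      by (rule order_trans[OF vb[OF seg(4)] mult_left_mono[OF eq_refl[OF len(4)]]])
         (use H in \<open>auto simp: a_def b'_def b_def closed_segment_same_Re closed_segment_eq_real_ivl\<close>)
    moreover have "cmod (u + (v + (w + z))) \<le> 2 * A + 2 * B"
      if "cmod u \<le> A" "cmod w \<le> A" "cmod v \<le> B" "cmod z \<le> B" for u v w z :: complex and A B
      using that norm_triangle_ineq[of u "v + (w + z)"] norm_triangle_ineq[of v "w + z"]
        norm_triangle_ineq[of w z] by linarith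
    ultimately have "cmod (contour_integral (rectpath a b) f) \<le>
        2 * (H / real Y ^ 2 * (3 * real N)) + 2 * (H / real N * (2 * real Y))"
      unfolding I by blast
    also have "\<dots> = 6 * (H / real M ^ 2) + 4 * (H / real M)"
    proof -
      have "real N / real Y ^ 2 = 1 / real M ^ 2" "real Y / real N = 1 / real M"
        using M by (simp_all add: N_def Y_def eval_nat_numeral field_simps)
      moreover have "2 * (H / real Y ^ 2 * (3 * real N)) + 2 * (H / real N * (2 * real Y)) =
          6 * (H * (real N / real Y ^ 2)) + 4 * (H * (real Y / real N))" by simp
      ultimately show ?thesis by simp
    qed
    also have "H / real M ^ 2 \<le> H / real M"
      using M H by (intro divide_left_mono) (auto simp: power2_eq_square)
    finally show ?thesis
      unfolding int(1) N_def[symmetric] by (simp add: H_def)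
  qed
  have "(\<lambda>M. 2 * pi * \<i> * residue_sum (M ^ 4)) \<longlonglongrightarrow> 0"
  proof (rule Lim_null_comparison)
    show "\<forall>\<^sub>F M in sequentially. cmod (2 * pi * \<i> * residue_sum (M ^ 4)) \<le>
        10 * C * (harm (8 * M ^ 4) ^ (k + 1) / real M)"
      using bound by (auto simp: eventually_sequentially intro!: exI[of _ 1])
    show "(\<lambda>M. 10 * C * (harm (8 * M ^ 4) ^ (k + 1) / real M)) \<longlonglongrightarrow> 0"
      by (rule tendsto_mult_right_zero[OF harm_power_over_tendsto_0])
  qed
  from tendsto_mult_left[OF this, of "1 / (2 * pi * \<i>)"] show ?thesis by simp
qed

end

text \<open>Multiplying out isolates the one product containing all \<open>h_seq\<close> factors;
  every other product misses at least one. The last two conjuncts are carried along for the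
  induction step.\<close>

lemma span_S_prod_expand:
  assumes "finite I" "\<And>i. i \<in> I \<Longrightarrow> c i \<in> lower_algebra k" "\<And>i. i \<in> I \<Longrightarrow> d i \<in> lower_algebra k"
    and "\<And>i. i \<in> I \<Longrightarrow> 1 \<le> p i" "\<And>i. i \<in> I \<Longrightarrow> s i \<in> {1, -1}"
  shows "\<exists>g. span_S.E k (card I) 0 g \<and>
    (\<forall>m. (\<Prod>i\<in>I. c i + d i * h_seq (p i) (s i) m) =
      (\<Prod>i\<in>I. d i) * (\<Prod>i\<in>I. h_seq (p i) (s i) m) + g m) \<and>
    span_S.E k (Suc (card I)) 0 (\<lambda>m. \<Prod>i\<in>I. h_seq (p i) (s i) m) \<and>
    (\<Prod>i\<in>I. d i) \<in> lower_algebra k"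
  using assms
proof (induction I rule: finite_induct)
  case empty
  then show ?case
    by (auto intro!: exI[of _ "\<lambda>_. 0"] span_S.zero span_S.E_const lower.one_mem)
next
  case (insert j I)
  obtain g where g: "span_S.E k (card I) 0 g"
    "\<And>m. (\<Prod>i\<in>I. c i + d i * h_seq (p i) (s i) m) =
      (\<Prod>i\<in>I. d i) * (\<Prod>i\<in>I. h_seq (p i) (s i) m) + g m"
    "span_S.E k (Suc (card I)) 0 (\<lambda>m. \<Prod>i\<in>I. h_seq (p i) (s i) m)"
    "(\<Prod>i\<in>I. d i) \<in> lower_algebra k"
    using insert.IH[OF insert.prems(1)[OF insertI2] insert.prems(2)[OF insertI2]
        insert.prems(3)[OF insertI2] insert.prems(4)[OF insertI2]] by blast
  define P D where "P = (\<lambda>m. \<Prod>i\<in>I. h_seq (p i) (s i) m)" and "D = (\<Prod>i\<in>I. d i)"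
  have X: "span_S.E k (Suc (Suc 0)) 0 (h_seq (p j) (s j))"
    using insert.prems by (intro span_S.E_X) auto
  have cX: "span_S.E k (Suc (Suc 0)) 0 (\<lambda>m. c j + d j * h_seq (p j) (s j) m)"
    using insert.prems by (intro span_S.E_add span_S.E_cmult[OF X] span_S.E_const) auto
  define g' where "g' = (\<lambda>m. c j * D * P m + (c j + d j * h_seq (p j) (s j) m) * g m)"
  have "span_S.E k (Suc (card I)) 0 (\<lambda>m. (c j * D) * P m)"
    using insert.prems g unfolding P_def D_def
    by (intro span_S.E_cmult lower.mult_mem) auto
  moreover have "span_S.E k (Suc (card I)) 0 (\<lambda>m. (c j + d j * h_seq (p j) (s j) m) * g m)"
    using span_S.E_mult[OF cX g(1)] by simp
  ultimately have "span_S.E k (Suc (card I)) 0 g'"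
    unfolding g'_def by (intro span_S.E_add)
  moreover have "span_S.E k (Suc (Suc (card I))) 0 (\<lambda>m. h_seq (p j) (s j) m * P m)"
    using span_S.E_mult[OF X g(3)] by (simp add: P_def)
  moreover have "d j * D \<in> lower_algebra k"
    using insert.prems g unfolding D_def by (intro lower.mult_mem) auto
  ultimately show ?case
    using insert.hyps g(2) by (intro exI[of _ g']) (auto simp: g'_def P_def D_def algebra_simps)
qed

context euler_kernel
begin

text \<open>The vanishing residue sum is a linear equation for the S-sum with coefficient
  \<open>2\<close> or \<open>-2\<close>, up to the sign \<sigma>, and with all other terms in the
  lower algebra.\<close>

lemma euler_S_mem_lower_algebra:
  assumes parity: "even ((\<Sum>i=1..k. p i) + q + k) \<longleftrightarrow> even ((1 - (\<Prod>i=1..k. s i)) div 2)"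
  shows "of_real (euler_S k p s q \<sigma>) \<in> lower_algebra k"
proof -
  define c where "c = (\<lambda>i. lerch (p i) (s i) (1 / 2))"
  define d where "d = (\<lambda>i. (-1) ^ p i * of_int (s i) :: complex)"
  define P where "P = (\<lambda>m. \<Prod>i=1..k. h_seq (p i) (s i) m)"
  have c: "c i \<in> lower_algebra k" if "i \<in> {1..k}" for i
    unfolding c_def using k p s that by (intro lerch_half_mem) auto
  have m1: "(-1) ^ n \<in> lower_algebra k" for n
    using lower.power_mem[OF lower.of_int_mem[of "-1"]] by simp
  have d: "d i \<in> lower_algebra k" for i
    unfolding d_def by (intro lower.mult_mem m1 lower.of_int_mem)
  obtain g where g: "span_S.E k k 0 g"
    "\<And>m. (\<Prod>i=1..k. c i + d i * h_seq (p i) (s i) m) = (\<Prod>i=1..k. d i) * P m + g m"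
    using span_S_prod_expand[of "{1..k}" c k d p s] c d p s unfolding P_def by auto
  obtain g' where g': "span_S.E k k 0 g'"
    "\<And>m. (\<Prod>i=1..k. c i + - 1 * h_seq (p i) (s i) m) = (\<Prod>i=1..k. - 1) * P m + g' m"
    using span_S_prod_expand[of "{1..k}" c k "\<lambda>_. - 1" p s] c m1[of 1] p s unfolding P_def by auto
  \<comment> \<open>The residues at \<open>n\<close> and \<open>-n\<close> contribute the degree
    \<open>k\<close> term with factors \<open>\<Prod>i=1..k. d i\<close> and
    \<open>(-1) ^ q * (-1) ^ k\<close>. As \<open>(1 - (\<Prod>i=1..k. s i)) div 2\<close> is
    \<open>0\<close> or \<open>1\<close>, the parity hypothesis makes the two equal.\<close>
  define \<kappa> where "\<kappa> = (\<Prod>i=1..k. d i) + (-1) ^ (q + k)"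
  have "(\<Prod>i=1..k. d i) = (-1) ^ (\<Sum>i=1..k. p i) * of_int (\<Prod>i=1..k. s i)"
    by (simp add: d_def prod.distrib power_sum)
  also have "\<dots> = (-1) ^ (q + k)"
  proof (cases "(\<Prod>i=1..k. s i) = 1")
    case True
    then have "even ((\<Sum>i=1..k. p i) + (q + k))" using parity by (simp add: add.assoc)
    then show ?thesis unfolding True by (simp add: uminus_power_if)
  next
    case False
    then have m: "(\<Prod>i=1..k. s i) = -1" using prod_s by auto
    then have "odd ((\<Sum>i=1..k. p i) + (q + k))" using parity by (simp add: add.assoc)
    then show ?thesis unfolding m by (simp add: uminus_power_if)
  qed
  finally have \<kappa>: "\<kappa> = 2 * (-1) ^ (q + k)" by (simp add: \<kappa>_def)
  define G where "G = (\<lambda>m. (g m + (-1) ^ q * g' m) * (1 / nat_pole m ^ q))"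
  have "span_S.E k (k + Suc 0 - 1) (0 + q) G"
    unfolding G_def
    by (intro span_S.E_mult span_S.E_add span_S.E_cmult g g' m1 span_S.E_inverse_power) auto
  then obtain x where x: "x \<in> lower_algebra k" "(\<lambda>m. of_int \<sigma> ^ m * G m) sums x"
    using span_S_sums[of k k q G \<sigma>] q \<sigma> q_\<sigma> by auto
  have index: "euler_index k p s q \<sigma>"
    using p q s \<sigma> q_\<sigma> unfolding euler_index_def by auto
  define S where "S = complex_of_real (euler_S k p s q \<sigma>)"
  have S: "(\<lambda>m. of_int \<sigma> ^ m * (P m * (1 / nat_pole m ^ q))) sums S"
    using sums_of_real[OF summable_sums[OF summable_euler_S[OF index]], where ?'a = complex]
    by (simp add: S_def euler_S_def P_def h_seq_def nat_pole_def)
  have pair: "residue f (of_int (int m + 1)) + residue f (of_int (- (int m + 1))) =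
      of_int \<sigma> * (\<kappa> * (of_int \<sigma> ^ m * (P m * (1 / nat_pole m ^ q))) + of_int \<sigma> ^ m * G m)" for m
    unfolding residues_pair g(2)[unfolded c_def d_def] g'(2)[unfolded c_def] G_def \<kappa>_def d_def
    by (simp add: algebra_simps power_add)
  have A: "(\<lambda>m. residue f (of_int (int m + 1)) + residue f (of_int (- (int m + 1)))) sums
      (of_int \<sigma> * (\<kappa> * S + x))"
    unfolding pair by (intro sums_mult sums_add S x)
  obtain e where e: "span_R.E k k q e" "\<And>m. residue f (half_pole m) = of_int \<sigma> ^ m * e m"
    using residue_half_pole by blast
  obtain r where r: "r \<in> lower_algebra k" "(\<lambda>m. residue f (half_pole m)) sums r"
    using span_R_sums[OF e(1)] q \<sigma> q_\<sigma> unfolding e(2) by auto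
  \<comment> \<open>Each of the three parts converges by itself, so the full sequence has a limit,
    which its vanishing along \<open>M ^ 4\<close> identifies.\<close>
  have "residue_sum \<longlonglongrightarrow> residue f 0 + of_int \<sigma> * (\<kappa> * S + x) + r"
    using A r(2) unfolding residue_sum_def[abs_def] sums_def by (intro tendsto_intros)
  then have "(\<lambda>M. residue_sum (M ^ 4)) \<longlonglongrightarrow> residue f 0 + of_int \<sigma> * (\<kappa> * S + x) + r"
    by (rule filterlim_compose) (rule filterlim_subseq, simp add: strict_mono_def power_strict_mono)
  then have "residue f 0 + of_int \<sigma> * (\<kappa> * S + x) + r = 0"
    using residue_sum_tendsto_0 by (rule LIMSEQ_unique)
  then have "of_int \<sigma> * (\<kappa> * S + x) = - (residue f 0 + r)"
    by (simp only: eq_neg_iff_add_eq_0 add_ac)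
  \<comment> \<open>Residues at \<open>n\<close> and \<open>-n\<close> carry
    \<open>\<sigma> ^ n\<close>, the S-sum carries \<open>\<sigma> ^ (n - 1)\<close>; multiplying by
    \<sigma> removes the surplus sign.\<close>
  then have "of_int \<sigma> * (of_int \<sigma> * (\<kappa> * S + x)) = - (of_int \<sigma> * (residue f 0 + r))"
    by (simp only: mult_minus_right)
  then have "\<kappa> * S = - (of_int \<sigma> * (residue f 0 + r)) - x"
    unfolding sign_mult_self(2)[OF \<sigma>] by (simp only: eq_diff_eq)
  moreover have "- (of_int \<sigma> * (residue f 0 + r)) - x \<in> lower_algebra k"
    by (intro lower.diff_mem lower.uminus_mem lower.mult_mem lower.add_mem lower.of_int_mem
        residue_0_mem r x)
  ultimately have "of_rat (1 / 2) * (-1) ^ (q + k) * (\<kappa> * S) \<in> lower_algebra k"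
    by (metis lower.mult_mem lower.rat_mem m1)
  also have "of_rat (1 / 2) * (-1) ^ (q + k) * (\<kappa> * S) = S"
    unfolding \<kappa> by (simp add: of_rat_divide flip: power_mult_distrib mult.assoc)
  finally show ?thesis by (simp add: S_def)
qed

end

theorem theorem5p2:
  fixes k q :: nat and p :: "nat \<Rightarrow> nat" and s :: "nat \<Rightarrow> int" and \<sigma> :: int
  assumes "k \<ge> 1"
    and "\<And>i. i \<in> {1..k} \<Longrightarrow> p i \<ge> 1"
    and "q \<ge> 1"
    and "\<And>i. i \<in> {1..k} \<Longrightarrow> s i \<in> {1, -1}"
    and "\<sigma> \<in> {1, -1}"
    and "(q, \<sigma>) \<noteq> (1, 1)"
    and "even ((\<Sum>i=1..k. p i) + q + k) \<longleftrightarrow> even ((1 - (\<Prod>i=1..k. s i)) div 2)"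
  shows "rat_polynomial_in (euler_sums_below k) (euler_S k p s q \<sigma>)"
proof -
  interpret euler_kernel k q p s \<sigma>
    using assms by unfold_locales auto
  \<comment> \<open>Injectivity of \<open>of_real\<close> brings the membership back to the real
    numbers.\<close>
  show ?thesis
    using euler_S_mem_lower_algebra[OF assms(7)] unfolding lower_algebra_def
    by (metis (mono_tags) image_iff mem_Collect_eq of_real_eq_iff)
qed

end
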